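(* Let $r=5-2\sqrt6$. The compact packings of the plane using discs of radius $1$ and $r$ are exactly the packings obtained by starting with a triangular lattice packing by discs of radius $1$ and, for each hole in some nonempty subset of its holes, putting into the hole a cluster of three mutually tangent discs of radius $r$, each tangent to exactly two of the three discs bounding the hole.
   Context: A packing of the plane is a collection of closed discs in $\mathbb{R}^2$ with pairwise disjoint interiors. A packing is compact if for every disc $D$ of the packing, the discs of the packing tangent to $D$, listed in cyclic order around $D$ as $D_1,\dots,D_n$ (with $D_{n+1}=D_1$), are such that $D_i$ is tangent to $D_{i+1}$ for $i=1,\dots,n$, and this chain surrounds $D$: the angles, in $(0,\pi)$, at the centre of $D$ in the triangles with vertices the centres of $D,D_i,D_{i+1}$ sum to $2\pi$. A compact packing using discs of radius $1$ and $r$ is a compact packing in which every disc has radius $1$ or $r$ and discs of both radii occur. The triangular lattice packing is the packing by discs of radius $1$ in which each disc is tangent to six others. Its holes are the bounded regions enclosed by triples of mutually tangent discs (the components of the complement of the union of the discs). *)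

theory Defs
  imports "HOL-Analysis.Analysis"
begin

text \<open>
  The Euclidean plane is the type \<^typ>\<open>complex\<close>. A closed disc is given by its centre and radius;
  since \<open>is_packing\<close> requires positive radii, this data is determined by the point set \<open>body D\<close>.
\<close>

type_synonym disc = "complex \<times> real"

abbreviation centre :: "disc \<Rightarrow> complex" where "centre \<equiv> fst"
abbreviation radius :: "disc \<Rightarrow> real" where "radius \<equiv> snd"

definition body :: "disc \<Rightarrow> complex set" where
  "body D = cball (centre D) (radius D)"

definition is_packing :: "disc set \<Rightarrow> bool" where
  "is_packing P \<longleftrightarrow>
     (\<forall>D\<in>P. radius D > 0) \<and>
     (\<forall>D\<in>P. \<forall>E\<in>P. D \<noteq> E \<longrightarrow> interior (body D) \<inter> interior (body E) = {})"

text \<open>External tangency, the only kind possible between discs with disjoint interiors.\<close>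

definition tangent :: "disc \<Rightarrow> disc \<Rightarrow> bool" where
  "tangent D E \<longleftrightarrow> dist (centre D) (centre E) = radius D + radius E"

definition neighbours :: "disc set \<Rightarrow> disc \<Rightarrow> disc set" where
  "neighbours P D = {E \<in> P. E \<noteq> D \<and> tangent D E}"

definition angle_at :: "complex \<Rightarrow> complex \<Rightarrow> complex \<Rightarrow> real" where
  "angle_at p a b = arccos (((a - p) \<bullet> (b - p)) / (norm (a - p) * norm (b - p)))"

text \<open>
  In a packing, distinct discs tangent to \<open>D\<close> lie in distinct directions from its centre, so
  sorting them strictly by direction is the counterclockwise listing, starting at the positive
  horizontal direction.
\<close>

definition cyclic_listing :: "disc set \<Rightarrow> disc \<Rightarrow> disc list \<Rightarrow> bool" where
  "cyclic_listing P D ds \<longleftrightarrow>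
     set ds = neighbours P D \<and>
     sorted_wrt (\<lambda>E F. Arg2pi (centre E - centre D) < Arg2pi (centre F - centre D)) ds"

text \<open>
  Indices are taken modulo the length, so the last disc is followed by the first. For three
  mutually tangent discs the centres form a nondegenerate triangle, hence \<open>angle_at\<close> is in
  \<open>(0, \<pi>)\<close> at all places where it is summed.
\<close>

definition surrounded :: "disc set \<Rightarrow> disc \<Rightarrow> bool" where
  "surrounded P D \<longleftrightarrow>
     (\<exists>ds. cyclic_listing P D ds \<and>
        (\<forall>i<length ds. tangent (ds ! i) (ds ! (Suc i mod length ds))) \<and>
        (\<Sum>i<length ds. angle_at (centre D) (centre (ds ! i))
            (centre (ds ! (Suc i mod length ds)))) = 2 * pi)"

definition compact_packing :: "disc set \<Rightarrow> bool" where
  "compact_packing P \<longleftrightarrow> is_packing P \<and> (\<forall>D\<in>P. surrounded P D)"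

definition compact_packing_using :: "real \<Rightarrow> real \<Rightarrow> disc set \<Rightarrow> bool" where
  "compact_packing_using \<rho> \<sigma> P \<longleftrightarrow> compact_packing P \<and> radius ` P = {\<rho>, \<sigma>}"

definition triangular_lattice_packing :: "disc set \<Rightarrow> bool" where
  "triangular_lattice_packing T \<longleftrightarrow>
     is_packing T \<and> T \<noteq> {} \<and> (\<forall>D\<in>T. radius D = 1) \<and> (\<forall>D\<in>T. card (neighbours T D) = 6)"

definition holes :: "disc set \<Rightarrow> complex set set" where
  "holes T = components (- (\<Union>D\<in>T. body D))"

definition bounding_discs :: "disc set \<Rightarrow> complex set \<Rightarrow> disc set" where
  "bounding_discs T H = {D \<in> T. body D \<inter> closure H \<noteq> {}}"

text \<open>
  A disc put into an (open) hole touches the boundary of the hole, so only its interior can be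
  required to lie in it.
\<close>

definition is_cluster :: "disc set \<Rightarrow> real \<Rightarrow> complex set \<Rightarrow> disc set \<Rightarrow> bool" where
  "is_cluster T r H C \<longleftrightarrow>
     card C = 3 \<and>
     (\<forall>D\<in>C. radius D = r \<and> interior (body D) \<subseteq> H) \<and>
     (\<forall>D\<in>C. \<forall>E\<in>C. D \<noteq> E \<longrightarrow> tangent D E) \<and>
     (\<forall>D\<in>C. card {B \<in> bounding_discs T H. tangent D B} = 2)"

end

theory Submission
  imports Defs
begin

text \<open>
  Around a disc of a compact packing, each neighbour has a counterclockwise successor whose position
  is determined by the three radii. At a small disc that touches a large one, following the
  successors without creating an overlap leaves a single possibility: the corona consists of two large
  and two small discs, arranged as in a cluster. Hence around a large disc, every large neighbour has
  another one at 60 degrees, either directly or beyond two small discs, and the large discs form a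
  triangular lattice. A small disc with only small neighbours would be the centre of a regular hexagon
  of small discs, which does not fit into a hole.

  No description of the shape of a hole is needed: the inscribed circle of a lattice triangle
  passes through the three points of tangency and is covered by the discs, so a hole that meets the
  open disc bounded by this circle lies in it. Positions near a lattice point D are written as
  D + u * z with u a unit vector, so that all estimates concern explicit numbers z.
\<close>

subsection \<open>Packings and surrounded discs\<close>

text \<open>The value of \<open>r\<close> is the one for which the angles at a small disc with
  neighbours large, large, small, small add up to a full turn (\<open>rot_product\<close>).
  Compactness is stated with angles, packing with distances; the link is the sign of
  \<open>orient\<close>. Since arccos of a cosine never exceeds the gap between consecutive
  directions, and both families sum to \<open>2 * pi\<close>, every angle is its gap, and the next
  neighbour lies to the left of the current one. Afterwards a successor is multiplication by a fixed
  complex number whose coordinates are surds, a sequence of successors is a product, and an overlap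
  is recognised by comparing a real part with a constant. A cluster is addressed by a directed side
  of its lattice triangle, so each filled hole has three addresses. A recurring task is to recognise
  that two addresses belong to the same hole; \<open>small_at_determined\<close> settles it. The
  lattice itself is handled through local conditions (\<open>hexagonal\<close>), without a choice of
  generators.\<close>

lemma ball_disjoint_iff:
  fixes x y :: complex
  assumes "a > 0" "b > 0"
  shows "ball x a \<inter> ball y b = {} \<longleftrightarrow> a + b \<le> dist x y"
proof
  assume disj: "ball x a \<inter> ball y b = {}"
  show "a + b \<le> dist x y"
  proof (rule ccontr)
    assume "\<not> a + b \<le> dist x y"
    hence lt: "dist x y < a + b" by simp
    \<comment> \<open>This point divides the segment of centres in the ratio \<open>a\<close> to
      \<open>b\<close>; if the centres are too close, it lies in both balls.\<close>
    define z where "z = x + (a / (a + b)) *\<^sub>R (y - x)"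
    have "z - x = (a / (a + b)) *\<^sub>R (y - x)" by (simp add: z_def)
    moreover have "z - y = - ((b / (a + b)) *\<^sub>R (y - x))"
    proof -
      have "1 = a / (a + b) + b / (a + b)" using assms by (simp add: add_divide_distrib[symmetric])
      hence "y - x = (a / (a + b) + b / (a + b)) *\<^sub>R (y - x)" by simp
      hence "y - x = (a / (a + b)) *\<^sub>R (y - x) + (b / (a + b)) *\<^sub>R (y - x)"
        by (simp only: scaleR_add_left)
      thus ?thesis unfolding z_def by (simp add: algebra_simps)
    qed
    ultimately have "norm (z - x) = a / (a + b) * norm (y - x)" "norm (z - y) = b / (a + b) * norm (y - x)"
      using assms by simp_all
    hence "dist x z = a / (a + b) * dist x y" "dist y z = b / (a + b) * dist x y"
      by (simp_all only: dist_norm norm_minus_commute[of x z] norm_minus_commute[of y z] norm_minus_commute[of x y])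
    moreover have "t / (a + b) * dist x y < t" if "t > 0" for t
      using mult_strict_left_mono[OF lt that] assms by (simp add: field_simps)
    ultimately have "dist x z < a" "dist y z < b" using assms by simp_all
    thus False using disj by auto
  qed
qed (rule disjoint_ballI)

lemma is_packing_iff:
  "is_packing P \<longleftrightarrow> (\<forall>D\<in>P. radius D > 0) \<and>
    (\<forall>D\<in>P. \<forall>E\<in>P. D \<noteq> E \<longrightarrow> radius D + radius E \<le> dist (centre D) (centre E))"
  unfolding is_packing_def body_def interior_cball
  by (intro conj_cong ball_cong imp_cong refl) (simp add: ball_disjoint_iff)

text \<open>Twice the signed area of the triangle. It is positive exactly when the direction of
  \<open>f\<close> from \<open>d\<close> is reached from that of \<open>e\<close> by a
  counterclockwise turn of less than \<open>pi\<close>, and unlike a comparison of arguments it has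
  no jump on the positive axis.\<close>

definition orient :: "complex \<Rightarrow> complex \<Rightarrow> complex \<Rightarrow> real" where
  "orient d e f = Im (cnj (e - d) * (f - d))"

lemma polar: "z = of_real (norm z) * cis (Arg2pi z)"
  by (metis Arg2pi_eq cis_conv_exp mult.commute)

lemma orient_polar:
  "orient d e f = norm (e - d) * norm (f - d) * sin (Arg2pi (f - d) - Arg2pi (e - d))"
proof -
  have "cnj (e - d) * (f - d)
      = of_real (norm (e - d) * norm (f - d)) * (cis (- Arg2pi (e - d)) * cis (Arg2pi (f - d)))"
    by (subst (1) polar[of "e - d"], subst (1) polar[of "f - d"]) (simp add: cis_cnj)
  also have "\<dots> = of_real (norm (e - d) * norm (f - d)) * cis (Arg2pi (f - d) - Arg2pi (e - d))"
    by (simp add: cis_mult)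
  finally show ?thesis unfolding orient_def by simp
qed

lemma inner_polar:
  "(e - d) \<bullet> (f - d) = norm (e - d) * norm (f - d) * cos (Arg2pi (f - d) - Arg2pi (e - d))"
proof -
  have "(e - d) \<bullet> (f - d) = Re (cnj (e - d) * (f - d))"
    by (simp add: inner_complex_def algebra_simps)
  also have "cnj (e - d) * (f - d)
      = of_real (norm (e - d) * norm (f - d)) * (cis (- Arg2pi (e - d)) * cis (Arg2pi (f - d)))"
    by (subst (1) polar[of "e - d"], subst (1) polar[of "f - d"]) (simp add: cis_cnj)
  also have "\<dots> = of_real (norm (e - d) * norm (f - d)) * cis (Arg2pi (f - d) - Arg2pi (e - d))"
    by (simp add: cis_mult)
  finally show ?thesis by simp
qed

lemma angle_at_polar:
  assumes "e \<noteq> d" "f \<noteq> d"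
  shows "angle_at d e f = arccos (cos (Arg2pi (f - d) - Arg2pi (e - d)))"
  unfolding angle_at_def inner_polar using assms by simp

text \<open>For increasing directions in [0, 2 pi) these are the counterclockwise steps from each
  direction to the next; the second branch is the step that closes the circle.\<close>

definition gap :: "(nat \<Rightarrow> real) \<Rightarrow> nat \<Rightarrow> nat \<Rightarrow> real" where
  "gap a n i = (if Suc i < n then a (Suc i) - a i else 2 * pi + a 0 - a i)"

lemma sum_gap:
  assumes "n > 0"
  shows "(\<Sum>i<n. gap a n i) = 2 * pi"
proof -
  obtain m where n: "n = Suc m" using assms by (cases n) auto
  have "(\<Sum>i<m. gap a n i) = (\<Sum>i<m. a (Suc i) - a i)"
    by (rule sum.cong) (auto simp: gap_def n)
  also have "\<dots> = a m - a 0" by (rule sum_lessThan_telescope)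
  finally show ?thesis by (simp add: n gap_def)
qed

lemma arccos_cos_le: "x \<ge> 0 \<Longrightarrow> arccos (cos x) \<le> x"
  by (cases "x \<le> pi") (auto simp: arccos_cos intro: order_trans[OF arccos_ubound])

lemma sum_eq_pointwise:
  fixes f g :: "'a \<Rightarrow> real"
  assumes "finite A" "\<And>i. i \<in> A \<Longrightarrow> f i \<le> g i" "sum f A = sum g A" "i \<in> A"
  shows "f i = g i"
proof -
  have "sum (\<lambda>i. g i - f i) A = 0" using assms(3) by (simp add: sum_subtractf)
  hence "\<forall>i\<in>A. g i - f i = 0"
    using sum_nonneg_eq_0_iff[OF assms(1), of "\<lambda>i. g i - f i"] assms(2) by auto
  thus ?thesis using assms(4) by auto
qed

text \<open>The gap and the plain difference of cyclically consecutive directions agree up to a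
  multiple of \<open>2 * pi\<close>.\<close>

lemma sin_cos_gap:
  assumes "i < n"
  shows "sin (gap a n i) = sin (a (Suc i mod n) - a i)"
    and "cos (gap a n i) = cos (a (Suc i mod n) - a i)"
proof -
  have "sin (gap a n i) = sin (a (Suc i mod n) - a i) \<and> cos (gap a n i) = cos (a (Suc i mod n) - a i)"
  proof (cases "Suc i < n")
    case False
    hence "Suc i = n" using assms by auto
    thus ?thesis using sin_periodic[of "a 0 - a i"] cos_periodic[of "a 0 - a i"]
      by (simp add: gap_def algebra_simps)
  qed (simp add: gap_def)
  thus "sin (gap a n i) = sin (a (Suc i mod n) - a i)"
    and "cos (gap a n i) = cos (a (Suc i mod n) - a i)" by auto
qed

lemma neighbours_centre:
  assumes "is_packing P" "D \<in> P" "E \<in> neighbours P D"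
  shows "E \<in> P" "norm (centre E - centre D) = radius D + radius E" "radius D > 0" "radius E > 0"
    "centre E \<noteq> centre D"
proof -
  show "E \<in> P" and n: "norm (centre E - centre D) = radius D + radius E"
    using assms by (auto simp: neighbours_def tangent_def dist_norm norm_minus_commute)
  show "radius D > 0" "radius E > 0"
    using assms \<open>E \<in> P\<close> by (auto simp: is_packing_iff)
  with n show "centre E \<noteq> centre D" by auto
qed

text \<open>Each angle is at most the corresponding gap, and both sum to \<open>2 * pi\<close>, so
  they agree one by one. Hence every gap is at most \<open>pi\<close>, and once \<open>pi\<close> is
  excluded the sine is positive. An empty listing would have angle sum 0.\<close>

lemma surrounded_successor:
  assumes pk: "is_packing P" and D: "D \<in> P" and s: "surrounded P D"
  shows "neighbours P D \<noteq> {}"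
    and "\<forall>E\<in>neighbours P D. \<exists>F\<in>neighbours P D. tangent E F \<and> orient (centre D) (centre E) (centre F) > 0"
proof -
  let ?d = "centre D"
  obtain ds where set_ds: "set ds = neighbours P D"
    and sorted: "sorted_wrt (\<lambda>E F. Arg2pi (centre E - ?d) < Arg2pi (centre F - ?d)) ds"
    and tang: "\<And>i. i < length ds \<Longrightarrow> tangent (ds ! i) (ds ! (Suc i mod length ds))"
    and total: "(\<Sum>i<length ds. angle_at ?d (centre (ds ! i)) (centre (ds ! (Suc i mod length ds)))) = 2 * pi"
    using s unfolding surrounded_def cyclic_listing_def by blast
  define n where "n = length ds"
  define a where "a i = Arg2pi (centre (ds ! i) - ?d)" for i
  have n0: "n > 0" using total unfolding n_def by (cases ds) auto
  show "neighbours P D \<noteq> {}" using n0 set_ds n_def by auto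
  have mono: "a i < a j" if "i < j" "j < n" for i j
    using sorted_wrt_nth_less[OF sorted that(1)] that unfolding a_def n_def by simp
  have arange: "0 \<le> a i" "a i < 2 * pi" for i
    unfolding a_def by (auto simp: Arg2pi_ge_0 Arg2pi_lt_2pi)
  have gap_pos: "gap a n i > 0" if "i < n" for i
    using mono[of i "Suc i"] arange[of 0] arange[of i] that by (auto simp: gap_def)
  have mem: "ds ! i \<in> neighbours P D" if "i < n" for i
    using that set_ds n_def nth_mem by blast
  have angle: "angle_at ?d (centre (ds ! i)) (centre (ds ! (Suc i mod n))) = arccos (cos (gap a n i))"
    if i: "i < n" for i
  proof -
    have "Suc i mod n < n" using n0 by simp
    hence "centre (ds ! i) \<noteq> ?d" "centre (ds ! (Suc i mod n)) \<noteq> ?d"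
      using neighbours_centre(5)[OF pk D] mem i by auto
    thus ?thesis using sin_cos_gap(2)[of i n a] i
      by (subst angle_at_polar) (auto simp: a_def)
  qed
  have tight: "arccos (cos (gap a n i)) = gap a n i" if i: "i < n" for i
  proof (rule sum_eq_pointwise[where A = "{..<n}"])
    show "(\<Sum>i<n. arccos (cos (gap a n i))) = (\<Sum>i<n. gap a n i)"
      using total angle unfolding sum_gap[OF n0] n_def[symmetric] by simp
  qed (use i gap_pos arccos_cos_le less_imp_le in auto)
  show "\<forall>E\<in>neighbours P D. \<exists>F\<in>neighbours P D. tangent E F \<and> orient ?d (centre E) (centre F) > 0"
  proof
    fix E assume "E \<in> neighbours P D"
    then obtain i where i: "i < n" "E = ds ! i"
      using set_ds n_def by (metis in_set_conv_nth)
    define F where "F = ds ! (Suc i mod n)"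
    have F: "F \<in> neighbours P D" unfolding F_def using mem n0 by simp
    have t: "tangent E F" using tang[of i] i unfolding F_def n_def by simp
    note nE = neighbours_centre[OF pk D \<open>E \<in> neighbours P D\<close>] and nF = neighbours_centre[OF pk D F]
    have le: "gap a n i \<le> pi"
      using tight[OF i(1)] arccos_ubound[of "cos (gap a n i)"] by simp
    \<comment> \<open>Otherwise the centre of \<open>D\<close> lies between those of
      \<open>E\<close> and \<open>F\<close>, whose distance then exceeds
      \<open>radius E + radius F\<close> by twice the radius of \<open>D\<close>.\<close>
    have "gap a n i \<noteq> pi"
    proof
      assume "gap a n i = pi"
      hence "cos (Arg2pi (centre F - ?d) - Arg2pi (centre E - ?d)) = -1"
        using sin_cos_gap(2)[of i n a] i by (auto simp: a_def F_def)
      hence inn: "(centre E - ?d) \<bullet> (centre F - ?d) = - (norm (centre E - ?d) * norm (centre F - ?d))"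
        by (simp add: inner_polar)
      have norm_diff: "(norm (x - y))\<^sup>2 = (norm x)\<^sup>2 + (norm y)\<^sup>2 - 2 * (x \<bullet> y)" for x y :: complex
        by (simp add: power2_norm_eq_inner inner_diff inner_commute)
      have "(norm ((centre E - ?d) - (centre F - ?d)))\<^sup>2
          = (norm (centre E - ?d) + norm (centre F - ?d))\<^sup>2"
        using norm_diff[of "centre E - ?d" "centre F - ?d"] unfolding inn by (simp only: power2_sum)
      hence "norm (centre E - centre F) = norm (centre E - ?d) + norm (centre F - ?d)"
        by (simp add: power2_eq_iff_nonneg)
      moreover have "norm (centre E - centre F) = radius E + radius F"
        using t by (simp add: tangent_def dist_norm)
      ultimately show False using nE nF by simp
    qed
    hence "sin (gap a n i) > 0" using le gap_pos[OF i(1)] by (intro sin_gt_zero) auto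
    hence "orient ?d (centre E) (centre F) > 0"
      using sin_cos_gap(1)[of i n a] i nE nF
      by (auto simp: orient_polar a_def F_def)
    thus "\<exists>F\<in>neighbours P D. tangent E F \<and> orient ?d (centre E) (centre F) > 0"
      using F t by blast
  qed
qed


text \<open>In a common direction the two centres would be only the difference of the radii apart,
  less than their sum.\<close>

lemma same_direction:
  assumes pk: "is_packing P" and D: "D \<in> P"
    and E: "E \<in> neighbours P D" and F: "F \<in> neighbours P D"
    and eq: "Arg2pi (centre E - centre D) = Arg2pi (centre F - centre D)"
  shows "E = F"
proof (rule ccontr)
  assume "E \<noteq> F"
  note nE = neighbours_centre[OF pk D E] and nF = neighbours_centre[OF pk D F]
  let ?c = "cis (Arg2pi (centre F - centre D))"
  have "centre E - centre F = (centre E - centre D) - (centre F - centre D)" by simp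
  also have "\<dots> = of_real (radius D + radius E) * ?c - of_real (radius D + radius F) * ?c"
    using polar[of "centre E - centre D"] polar[of "centre F - centre D"] unfolding nE nF eq by simp
  also have "\<dots> = of_real (radius E - radius F) * ?c" by (simp add: algebra_simps)
  finally have "dist (centre E) (centre F) = \<bar>radius E - radius F\<bar>"
    by (simp add: dist_norm norm_mult del: of_real_diff)
  moreover have "radius E + radius F \<le> dist (centre E) (centre F)"
    using pk nE(1) nF(1) \<open>E \<noteq> F\<close> by (auto simp: is_packing_iff)
  ultimately show False using nE nF by linarith
qed

lemma sin_neg_shift:
  assumes "- 2 * pi < x" "x < - pi"
  shows "sin x > 0"
  using sin_gt_zero[of "x + 2 * pi"] assms by simp

lemma sin_pos_cases:
  assumes "sin x > 0" "- 2 * pi < x" "x < 2 * pi"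
  shows "(0 < x \<and> x < pi) \<or> x < - pi"
proof (rule ccontr)
  assume "\<not> ?thesis"
  then consider "- pi \<le> x" "x \<le> 0" | "pi \<le> x" by linarith
  thus False
  proof cases
    case 1
    hence "sin (- x) \<ge> 0" by (intro sin_ge_zero) auto
    thus False using assms by simp
  next
    case 2
    have "sin x = - sin (x - pi)" by (simp add: sin_diff)
    moreover have "sin (x - pi) \<ge> 0" using 2 assms by (intro sin_ge_zero) auto
    ultimately show False using assms by simp
  qed
qed

text \<open>A converse of \<open>surrounded_successor\<close> with hypotheses that can be checked
  algebraically: the last one, that no neighbour is to the left of \<open>E\<close> while having
  \<open>F\<close> to its left, forces \<open>F\<close> to be the entry after \<open>E\<close> in
  the sorted listing.\<close>

lemma surroundedI:
  assumes pk: "is_packing P" and D: "D \<in> P"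
    and fin: "finite (neighbours P D)" and ne: "neighbours P D \<noteq> {}"
    and succ: "\<And>E. E \<in> neighbours P D \<Longrightarrow> \<exists>F\<in>neighbours P D. tangent E F \<and>
      orient (centre D) (centre E) (centre F) > 0 \<and>
      (\<forall>G\<in>neighbours P D. \<not> (orient (centre D) (centre E) (centre G) > 0 \<and>
                                 orient (centre D) (centre G) (centre F) > 0))"
  shows "surrounded P D"
proof -
  let ?d = "centre D" and ?N = "neighbours P D"
  define A where "A E = Arg2pi (centre E - ?d)" for E :: disc
  have inj: "inj_on A ?N"
    using same_direction[OF pk D] unfolding A_def by (intro inj_onI) blast
  define ds where "ds = map (the_inv_into ?N A) (sorted_list_of_set (A ` ?N))"
  have map_A: "map A ds = sorted_list_of_set (A ` ?N)"
    unfolding ds_def map_map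
    by (rule map_idI) (use fin inj in \<open>auto simp: the_inv_into_f_f\<close>)
  have set_ds: "set ds = ?N"
    unfolding ds_def using fin inj by (auto simp: the_inv_into_f_f image_image)
  have "sorted_wrt (<) (map A ds)"
    unfolding map_A by (rule strict_sorted_list_of_set)
  hence sorted: "sorted_wrt (\<lambda>E F. A E < A F) ds" by (simp add: sorted_wrt_map)
  hence listing: "cyclic_listing P D ds"
    unfolding cyclic_listing_def A_def using set_ds by blast
  define n where "n = length ds"
  define a where "a i = A (ds ! i)" for i
  have n0: "n > 0" using ne set_ds unfolding n_def by auto
  have mono: "a i < a j" if "i < j" "j < n" for i j
    using sorted_wrt_nth_less[OF sorted that(1)] that unfolding a_def n_def by simp
  have arange: "0 \<le> a i" "a i < 2 * pi" for i
    unfolding a_def A_def by (auto simp: Arg2pi_ge_0 Arg2pi_lt_2pi)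
  have mem: "ds ! i \<in> ?N" if "i < n" for i
    using that set_ds n_def nth_mem by blast
  have orient_a: "orient ?d (centre (ds ! i)) (centre (ds ! j)) > 0 \<longleftrightarrow> sin (a j - a i) > 0"
    if "i < n" "j < n" for i j
  proof -
    have "norm (centre (ds ! i) - ?d) * norm (centre (ds ! j) - ?d) > 0"
      using neighbours_centre(5)[OF pk D mem] that by simp
    thus ?thesis unfolding orient_polar a_def A_def by (metis mult_pos_pos zero_less_mult_pos)
  qed
  have key: "tangent (ds ! i) (ds ! (Suc i mod n)) \<and> sin (gap a n i) > 0" if i: "i < n" for i
  proof -
    obtain F where F: "F \<in> ?N" "tangent (ds ! i) F" "orient ?d (centre (ds ! i)) (centre F) > 0"
      and no: "\<And>G. G \<in> ?N \<Longrightarrow> \<not> (orient ?d (centre (ds ! i)) (centre G) > 0 \<and>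
                                 orient ?d (centre G) (centre F) > 0)"
      using succ[OF mem[OF i]] by blast
    obtain j where j: "j < n" "F = ds ! j"
      using F(1) set_ds n_def by (metis in_set_conv_nth)
    define k where "k = Suc i mod n"
    have k: "k < n" using n0 by (simp add: k_def)
    have pos: "sin (a j - a i) > 0" using F(3) orient_a[OF i j(1)] j by simp
    have nobet: "\<not> (sin (a k - a i) > 0 \<and> sin (a j - a k) > 0)"
      using no[OF mem[OF k]] orient_a[OF i k] orient_a[OF k j(1)] j by simp
    have cases: "(0 < a j - a i \<and> a j - a i < pi) \<or> a j - a i < - pi"
      by (rule sin_pos_cases[OF pos]) (use arange[of i] arange[of j] in auto)
    \<comment> \<open>If not, the entry \<open>k\<close> right after \<open>i\<close> would itself
      lie between \<open>i\<close> and \<open>j\<close>. The cases record whether the step from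
      \<open>i\<close> to \<open>j\<close>, or already the one from \<open>i\<close> to
      \<open>k\<close>, passes the positive axis.\<close>
    have "j = k"
    proof (rule ccontr)
      assume jk: "j \<noteq> k"
      show False
      proof (cases "Suc i < n")
        case True
        hence ki: "k = Suc i" by (simp add: k_def)
        have aik: "a i < a k" using mono[of i k] ki k by simp
        show False
        proof (cases "i < j")
          case True
          hence "a k < a j" using mono[of k j] j jk ki by simp
          moreover have "a j - a i < pi" using cases mono[OF True j(1)] pi_gt_zero by linarith
          ultimately show False using nobet aik sin_gt_zero[of "a k - a i"] sin_gt_zero[of "a j - a k"] by auto
        next
          case False
          hence "a j \<le> a i" using mono[of j i] i by (cases "i = j") auto
          hence "a j - a i < - pi" using cases by linarith
          moreover have "sin (a k - a i) > 0"
            by (rule sin_gt_zero) (use aik arange[of k] arange[of j] calculation in auto)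
          moreover have "sin (a j - a k) > 0"
            by (rule sin_neg_shift) (use aik arange[of k] arange[of j] calculation in auto)
          ultimately show False using nobet by blast
        qed
      next
        case False
        hence ni: "Suc i = n" using i by simp
        hence k0: "k = 0" by (simp add: k_def)
        have ji: "j < i"
        proof (rule ccontr)
          assume "\<not> j < i"
          hence "j = i" using j ni by simp
          thus False using pos by simp
        qed
        have 1: "a j < a i" using mono[OF ji i] .
        hence 2: "a j - a i < - pi" using cases by linarith
        have 3: "a 0 < a j" using mono[of 0 j] j jk k0 by simp
        have "sin (a 0 - a i) > 0"
          by (rule sin_neg_shift) (use 2 3 arange[of 0] arange[of i] in auto)
        moreover have "sin (a j - a 0) > 0"
          by (rule sin_gt_zero) (use 2 3 arange[of 0] arange[of i] in auto)
        ultimately show False using nobet k0 by simp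
      qed
    qed
    thus ?thesis using F(2) j pos sin_cos_gap(1)[OF i, of a] by (simp add: k_def)
  qed
  have angle: "angle_at ?d (centre (ds ! i)) (centre (ds ! (Suc i mod n))) = gap a n i"
    if i: "i < n" for i
  proof -
    have "Suc i mod n < n" using n0 by simp
    hence "centre (ds ! i) \<noteq> ?d" "centre (ds ! (Suc i mod n)) \<noteq> ?d"
      using neighbours_centre(5)[OF pk D] mem i by auto
    hence "angle_at ?d (centre (ds ! i)) (centre (ds ! (Suc i mod n))) = arccos (cos (gap a n i))"
      using sin_cos_gap(2)[OF i, of a] by (subst angle_at_polar) (auto simp: a_def A_def)
    moreover have "gap a n i > 0"
      using mono[of i "Suc i"] arange[of 0] arange[of i] by (auto simp: gap_def)
    moreover have "gap a n i \<le> 2 * pi"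
      using arange[of "Suc i"] arange[of 0] arange[of i] mono[of 0 i] i n0
      by (cases "i = 0") (auto simp: gap_def)
    moreover have "gap a n i < pi"
    proof (rule ccontr)
      assume "\<not> gap a n i < pi"
      hence "sin (gap a n i - pi) \<ge> 0" using calculation by (intro sin_ge_zero) auto
      thus False using key[OF i] by (simp add: sin_diff)
    qed
    ultimately show ?thesis by (simp add: arccos_cos)
  qed
  have "(\<Sum>i<n. angle_at ?d (centre (ds ! i)) (centre (ds ! (Suc i mod n)))) = 2 * pi"
    using angle sum_gap[OF n0, of a] by simp
  thus ?thesis
    unfolding surrounded_def using listing key unfolding n_def by blast
qed

text \<open>After division by \<open>e - d\<close> the triangle has base 0, 1. The two remaining
  sides fix its third vertex up to conjugation, and the orientation selects the upper
  half-plane.\<close>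

lemma third_vertex:
  assumes "e \<noteq> d" and "norm (f - d) = norm z * norm (e - d)"
    and "norm (f - e) = norm (z - 1) * norm (e - d)"
    and "orient d e f > 0" "Im z > 0"
  shows "f = d + (e - d) * z"
proof -
  define y where "y = (f - d) / (e - d)"
  have f: "f - d = (e - d) * y" using assms(1) by (simp add: y_def)
  hence "f - e = (e - d) * (y - 1)" by (simp add: algebra_simps)
  hence n: "norm y = norm z" "norm (y - 1) = norm (z - 1)"
    using assms f by (auto simp: norm_mult)
  have "cnj (e - d) * (f - d) = of_real ((norm (e - d))\<^sup>2) * y"
    unfolding f complex_norm_square by simp
  hence "orient d e f = (norm (e - d))\<^sup>2 * Im y" unfolding orient_def by simp
  hence "Im y > 0" using assms(1,4) by (simp add: zero_less_mult_iff)
  have sq: "(Re y)\<^sup>2 + (Im y)\<^sup>2 = (Re z)\<^sup>2 + (Im z)\<^sup>2"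
    "(Re y - 1)\<^sup>2 + (Im y)\<^sup>2 = (Re z - 1)\<^sup>2 + (Im z)\<^sup>2"
    using n by (auto simp: cmod_def)
  hence "Re y = Re z" by (simp add: power2_diff)
  moreover from this sq have "Im y = Im z" using \<open>Im y > 0\<close> assms(5)
    by (simp add: power2_eq_iff_nonneg)
  ultimately have "y = z" by (simp add: complex_eq_iff)
  thus ?thesis using f by (simp add: algebra_simps)
qed

subsection \<open>Hexagonal point sets and their holes\<close>

text \<open>The primitive sixth root of unity, that is, rotation by 60 degrees; \<open>hexad\<close>
  lists its powers in counterclockwise order.\<close>

definition zeta :: complex where "zeta = Complex (1/2) (sqrt 3 / 2)"

abbreviation hexad :: "complex set" where "hexad \<equiv> {1, zeta, zeta - 1, -1, - zeta, 1 - zeta}"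

text \<open>By symmetry the real part is 1. The imaginary part is the root of
  \<open>(1 + r)\<^sup>2 - 1 = 59 - 24 * sqrt 6\<close>, which is the square of
  \<open>4 * sqrt 2 - 3 * sqrt 3\<close>.\<close>

definition apex :: complex where "apex = Complex 1 (4 * sqrt 2 - 3 * sqrt 3)"

text \<open>
  The centre of the disc of radius r that is tangent to the unit discs centred at D and
  D + 2 * u and lies to the left of the direction u; below, apex2 and apex3 play the role of apex for
  the other two discs of the cluster in the hole bounded by D, D + 2 * u and D + 2 * (u * zeta).
\<close>

definition small_at :: "complex \<Rightarrow> complex \<Rightarrow> complex" where
  "small_at D u = D + u * apex"

text \<open>The centroid of the lattice triangle with side from \<open>D\<close> to
  \<open>D + 2 * u\<close> and third corner to the left; its incircle has radius
  \<open>sqrt 3 / 3\<close>.\<close>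

definition hole_centre :: "complex \<Rightarrow> complex \<Rightarrow> complex" where
  "hole_centre D u = D + u * Complex 1 (sqrt 3 / 3)"

text \<open>A local description of the triangular lattice of mesh 2: neighbours exist, turning by 60
  degrees leads from neighbour to neighbour, and points are separated. The empty set qualifies, so
  nonemptiness is required separately.\<close>

definition hexagonal :: "complex set \<Rightarrow> bool" where
  "hexagonal T \<longleftrightarrow> (\<forall>D\<in>T. \<exists>u. norm u = 1 \<and> D + 2 * u \<in> T) \<and>
     (\<forall>D\<in>T. \<forall>u. norm u = 1 \<longrightarrow> D + 2 * u \<in> T \<longrightarrow> D + 2 * (u * zeta) \<in> T) \<and>
     (\<forall>D\<in>T. \<forall>E\<in>T. D \<noteq> E \<longrightarrow> 2 \<le> dist D E)"

section \<open>Arithmetic with square roots and rotated frames\<close>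

lemma sqrt_bounds:
  "1414213/1000000 < sqrt 2" "sqrt 2 < 1414214/1000000"
  "1732050/1000000 < sqrt 3" "sqrt 3 < 1732051/1000000"
  "2449489/1000000 < sqrt 6" "sqrt 6 < 2449490/1000000"
  by (rule real_less_rsqrt real_less_lsqrt; simp add: power2_eq_square)+

text \<open>Products of 1, \<open>sqrt 2\<close>, \<open>sqrt 3\<close>, \<open>sqrt 6\<close> are
  multiples of the same four numbers. With these rules polynomial expressions in surds become
  linear, and \<open>sqrt_bounds\<close> decides their sign.\<close>

lemma surd_mult:
  "sqrt 2 * sqrt 2 = 2" "sqrt 3 * sqrt 3 = 3" "sqrt 6 * sqrt 6 = 6"
  "sqrt 2 * sqrt 3 = sqrt 6" "sqrt 3 * sqrt 2 = sqrt 6"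
  "sqrt 2 * sqrt 6 = 2 * sqrt 3" "sqrt 6 * sqrt 2 = 2 * sqrt 3"
  "sqrt 3 * sqrt 6 = 3 * sqrt 2" "sqrt 6 * sqrt 3 = 3 * sqrt 2"
proof -
  show "sqrt 2 * sqrt 2 = 2" "sqrt 3 * sqrt 3 = 3" "sqrt 6 * sqrt 6 = 6" by simp_all
  show *: "sqrt 2 * sqrt 3 = sqrt 6" by (simp flip: real_sqrt_mult)
  thus "sqrt 3 * sqrt 2 = sqrt 6" by (simp add: mult.commute)
  show "sqrt 2 * sqrt 6 = 2 * sqrt 3" "sqrt 6 * sqrt 2 = 2 * sqrt 3"
    "sqrt 3 * sqrt 6 = 3 * sqrt 2" "sqrt 6 * sqrt 3 = 3 * sqrt 2"
    unfolding *[symmetric] by simp_all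
qed

lemma surd_mult_left:
  "sqrt 2 * (sqrt 2 * x) = 2 * x" "sqrt 3 * (sqrt 3 * x) = 3 * x" "sqrt 6 * (sqrt 6 * x) = 6 * x"
  "sqrt 2 * (sqrt 3 * x) = sqrt 6 * x" "sqrt 3 * (sqrt 2 * x) = sqrt 6 * x"
  "sqrt 2 * (sqrt 6 * x) = 2 * sqrt 3 * x" "sqrt 6 * (sqrt 2 * x) = 2 * sqrt 3 * x"
  "sqrt 3 * (sqrt 6 * x) = 3 * sqrt 2 * x" "sqrt 6 * (sqrt 3 * x) = 3 * sqrt 2 * x"
  by (simp_all only: mult.assoc[symmetric] surd_mult)

lemmas surd_simps = surd_mult surd_mult_left

lemma norm_sq: "(norm z)\<^sup>2 = (Re z)\<^sup>2 + (Im z)\<^sup>2"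
  by (simp add: cmod_def)

lemma norm_eq_surd: "x \<ge> 0 \<Longrightarrow> (Re z)\<^sup>2 + (Im z)\<^sup>2 = x\<^sup>2 \<Longrightarrow> norm z = x"
  by (metis norm_sq norm_ge_zero power2_eq_iff_nonneg)

lemma norm_zeta [simp]: "norm zeta = 1"
  by (rule norm_eq_surd) (auto simp: zeta_def power2_eq_square)

lemma zeta_sq: "zeta\<^sup>2 = zeta - 1" "zeta * zeta = zeta - 1" "zeta * (zeta * x) = (zeta - 1) * x"
proof -
  show *: "zeta * zeta = zeta - 1"
    by (simp add: zeta_def complex_eq_iff)
  thus "zeta\<^sup>2 = zeta - 1" "zeta * (zeta * x) = (zeta - 1) * x"
    by (simp_all add: power2_eq_square mult.assoc[symmetric])
qed

lemma norm_frame: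
  fixes u :: complex
  shows "norm u = 1 \<Longrightarrow> norm (u * z) = norm z"
  by (simp add: norm_mult)

lemma dist_frame:
  fixes u :: complex
  shows "norm u = 1 \<Longrightarrow> dist (D + u * z) (D + u * z') = norm (z - z')"
  by (metis dist_norm add_diff_cancel_left norm_frame right_diff_distrib)

lemma frame_coords:
  fixes u :: complex
  assumes "norm u = 1"
  obtains z where "X = D + u * z"
proof -
  have "u \<noteq> 0" using assms by auto
  thus thesis by (intro that[of "(X - D) / u"]) simp
qed

lemma norm_apex: "norm apex = 6 - 2 * sqrt 6"
  by (rule norm_eq_surd) (use sqrt_bounds in \<open>auto simp: apex_def power2_eq_square algebra_simps surd_simps\<close>)

lemma norm_apex_other: "norm (apex - 2) = 6 - 2 * sqrt 6"
  by (rule norm_eq_surd) (use sqrt_bounds in \<open>auto simp: apex_def power2_eq_square algebra_simps surd_simps\<close>)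

definition apex2 :: complex where "apex2 = Complex (6 - 2 * sqrt 6) (2 * sqrt 3 - 2 * sqrt 2)"
definition apex3 :: complex where "apex3 = Complex (2 * sqrt 6 - 4) (2 * sqrt 3 - 2 * sqrt 2)"

text \<open>Going counterclockwise around the triangle, the directed sides start at
  \<open>D\<close>, \<open>D + 2 * u\<close>, \<open>D + 2 * (u * zeta)\<close> with directions
  \<open>u\<close>, \<open>u * (zeta - 1)\<close>, \<open>- (u * zeta)\<close>. The small disc at
  each side is expressed here in the frame of the first.\<close>

lemma small_at_turn:
  "small_at (D + 2 * u) (u * (zeta - 1)) = D + u * apex2"
  "small_at (D + 2 * (u * zeta)) (- (u * zeta)) = D + u * apex3"
proof -
  have "2 + (zeta - 1) * apex = apex2"
    by (simp add: zeta_def apex_def apex2_def complex_eq_iff algebra_simps surd_simps)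
  thus "small_at (D + 2 * u) (u * (zeta - 1)) = D + u * apex2"
    unfolding small_at_def by (simp add: algebra_simps flip: \<open>_ = apex2\<close>)
  have "2 * zeta - zeta * apex = apex3"
    by (simp add: zeta_def apex_def apex3_def complex_eq_iff algebra_simps surd_simps)
  thus "small_at (D + 2 * (u * zeta)) (- (u * zeta)) = D + u * apex3"
    unfolding small_at_def by (simp add: algebra_simps flip: \<open>_ = apex3\<close>)
qed

lemma hole_centre_turn:
  "hole_centre (D + 2 * u) (u * (zeta - 1)) = hole_centre D u"
  "hole_centre (D + 2 * (u * zeta)) (- (u * zeta)) = hole_centre D u"
proof -
  have "2 + (zeta - 1) * Complex 1 (sqrt 3 / 3) = Complex 1 (sqrt 3 / 3)"
    by (simp add: zeta_def complex_eq_iff algebra_simps)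
  thus "hole_centre (D + 2 * u) (u * (zeta - 1)) = hole_centre D u"
    unfolding hole_centre_def by (metis (no_types, opaque_lifting) add.assoc distrib_left mult.assoc mult.commute)
  have "2 * zeta - zeta * Complex 1 (sqrt 3 / 3) = Complex 1 (sqrt 3 / 3)"
    by (simp add: zeta_def complex_eq_iff algebra_simps)
  hence "u * (2 * zeta - zeta * Complex 1 (sqrt 3 / 3)) = u * Complex 1 (sqrt 3 / 3)" by simp
  thus "hole_centre (D + 2 * (u * zeta)) (- (u * zeta)) = hole_centre D u"
    unfolding hole_centre_def by (simp add: algebra_simps)
qed

text \<open>One of the six directions is within 30 degrees of \<open>z\<close>. With
  \<open>a\<close> and \<open>b\<close> the components along 1 and \<open>zeta\<close>, the
  component along \<open>zeta - 1\<close> is \<open>b - a\<close>, and three quarters of the squared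
  norm is \<open>a\<^sup>2 - a * b + b\<^sup>2\<close>, which never exceeds all three of the squared
  components.\<close>

lemma sextant:
  "\<exists>w\<in>hexad. sqrt 3 / 2 * norm z \<le> Re (z * cnj w)"
proof -
  define a b where "a = Re z" and "b = Re z / 2 + sqrt 3 / 2 * Im z"
  have q: "(sqrt 3 / 2 * norm z)\<^sup>2 = a\<^sup>2 - a * b + b\<^sup>2"
    unfolding power_mult_distrib norm_sq a_def b_def
    by (simp add: power2_eq_square field_simps surd_simps)
  have large: "sqrt 3 / 2 * norm z \<le> \<bar>x\<bar>" if "a\<^sup>2 - a * b + b\<^sup>2 \<le> x\<^sup>2" for x
    using that unfolding q[symmetric] by (metis abs_ge_self abs_le_square_iff order_trans)
  have "sqrt 3 / 2 * norm z \<le> \<bar>a\<bar> \<or> sqrt 3 / 2 * norm z \<le> \<bar>b\<bar> \<or> sqrt 3 / 2 * norm z \<le> \<bar>b - a\<bar>"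
  proof (cases "a * b \<ge> 0")
    case True
    have "a\<^sup>2 - a * b + b\<^sup>2 \<le> a\<^sup>2 \<or> a\<^sup>2 - a * b + b\<^sup>2 \<le> b\<^sup>2"
    proof (cases "b\<^sup>2 \<le> a * b")
      case False
      hence "\<not> \<bar>b\<bar> * \<bar>b\<bar> \<le> \<bar>a\<bar> * \<bar>b\<bar>" using True by (simp add: power2_eq_square flip: abs_mult)
      hence "\<bar>a\<bar> < \<bar>b\<bar>" by (meson abs_ge_zero mult_right_mono not_le)
      hence "\<bar>a\<bar> * \<bar>a\<bar> \<le> \<bar>a\<bar> * \<bar>b\<bar>" by (intro mult_left_mono) auto
      hence "a\<^sup>2 \<le> a * b" using True by (simp add: power2_eq_square flip: abs_mult)
      thus ?thesis by simp
    qed simp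
    thus ?thesis using large by blast
  next
    case False
    hence "a\<^sup>2 - a * b + b\<^sup>2 \<le> (b - a)\<^sup>2" by (simp add: power2_diff)
    thus ?thesis using large by blast
  qed
  moreover have "Re (z * cnj 1) = a" "Re (z * cnj zeta) = b" "Re (z * cnj (zeta - 1)) = b - a"
    "Re (z * cnj (- 1)) = - a" "Re (z * cnj (- zeta)) = - b" "Re (z * cnj (1 - zeta)) = - (b - a)"
    by (simp_all add: a_def b_def zeta_def algebra_simps)
  moreover have "m \<le> \<bar>x\<bar> \<longleftrightarrow> m \<le> x \<or> m \<le> - x" for m x :: real by linarith
  ultimately show ?thesis by (simp only: bex_simps) metis
qed

section \<open>Neighbours and distances in a hexagonal point set\<close>

lemma hexagonal_rotate:
  assumes T: "hexagonal T" and D: "D \<in> T" and u: "norm u = 1" "D + 2 * u \<in> T"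
  shows "\<forall>w\<in>hexad. D + 2 * (u * w) \<in> T \<and> norm (u * w) = 1"
proof -
  have step: "D + 2 * (v * zeta) \<in> T \<and> norm (v * zeta) = 1" if "D + 2 * v \<in> T \<and> norm v = 1" for v
    using that T D unfolding hexagonal_def by (simp add: norm_mult)
  note 1 = step[of u] and 2 = step[of "u * zeta"] and 3 = step[of "u * (zeta - 1)"] and 4 = step[of "u * -1"]
    and 5 = step[of "u * - zeta"]
  have "u * zeta * zeta = u * (zeta - 1)" "u * (zeta - 1) * zeta = u * - 1" "u * - 1 * zeta = u * - zeta"
    "u * - zeta * zeta = u * (1 - zeta)"
    by (simp_all add: algebra_simps zeta_sq)
  thus ?thesis using 1 2 3 4 5 u by (metis insertE empty_iff mult.right_neutral)
qed

lemma hexagonal_sep: "hexagonal T \<Longrightarrow> D \<in> T \<Longrightarrow> E \<in> T \<Longrightarrow> D \<noteq> E \<Longrightarrow> 2 \<le> dist D E"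
  by (auto simp: hexagonal_def)

lemma dist_shift_sq:
  assumes "norm u = 1"
  shows "(norm (z - (D + 2 * u)))\<^sup>2 = (norm (z - D))\<^sup>2 - 4 * Re ((z - D) * cnj u) + 4"
proof -
  have "(Re u)\<^sup>2 + (Im u)\<^sup>2 = 1" using assms norm_sq[of u] by simp
  thus ?thesis unfolding norm_sq by (simp add: power2_eq_square algebra_simps)
qed

text \<open>Some neighbour of any lattice point lies within 30 degrees of any prescribed direction.\<close>

lemma hexagonal_towards:
  assumes T: "hexagonal T" and D: "D \<in> T" and u: "norm u = 1" "D + 2 * u \<in> T"
  obtains w where "w \<in> hexad"
    "D + 2 * (u * w) \<in> T" "norm (u * w) = 1"
    "(norm (z - (D + 2 * (u * w))))\<^sup>2 \<le> (norm (z - D))\<^sup>2 - 2 * sqrt 3 * norm (z - D) + 4"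
proof -
  obtain w where w: "w \<in> hexad"
    "sqrt 3 / 2 * norm ((z - D) * cnj u) \<le> Re ((z - D) * cnj u * cnj w)"
    using sextant by blast
  have 1: "D + 2 * (u * w) \<in> T" "norm (u * w) = 1"
    using hexagonal_rotate[OF T D u] w(1) by blast+
  have "sqrt 3 / 2 * norm (z - D) \<le> Re ((z - D) * cnj (u * w))"
    using w(2) u by (simp add: norm_mult mult.assoc)
  thus thesis using that[OF w(1) 1] dist_shift_sq[OF 1(2), of z D] by simp
qed

text \<open>The second smallest lattice distance is \<open>2 * sqrt 3\<close>, more than 3. For
  \<open>t\<close> below it, \<open>t * (t - 2 * sqrt 3)\<close> is negative, so the neighbour of
  \<open>X\<close> towards \<open>Y\<close> is closer than 2 to \<open>Y\<close> and hence equals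
  it.\<close>

lemma hexagonal_close:
  assumes T: "hexagonal T" and XY: "X \<in> T" "Y \<in> T" "X \<noteq> Y" and lt: "dist X Y < 3"
  obtains u where "norm u = 1" "Y = X + 2 * u"
proof -
  obtain v where v: "norm v = 1" "X + 2 * v \<in> T" using T XY by (auto simp: hexagonal_def)
  obtain w where w: "X + 2 * (v * w) \<in> T" "norm (v * w) = 1"
    "(norm (Y - (X + 2 * (v * w))))\<^sup>2 \<le> (norm (Y - X))\<^sup>2 - 2 * sqrt 3 * norm (Y - X) + 4"
    by (rule hexagonal_towards[OF T XY(1) v, where z = Y], rule that)
  have "norm (Y - X) \<ge> 2" "norm (Y - X) < 3"
    using hexagonal_sep[OF T XY] lt by (auto simp: dist_norm norm_minus_commute)
  hence "norm (Y - X) * (norm (Y - X) - 2 * sqrt 3) < 0"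
    using sqrt_bounds(3) by (intro mult_pos_neg; linarith)
  hence "(norm (Y - (X + 2 * (v * w))))\<^sup>2 < 2\<^sup>2" using w(3)
    by (simp add: power2_eq_square algebra_simps)
  hence "dist Y (X + 2 * (v * w)) < 2" unfolding dist_norm by (rule power2_less_imp_less) simp
  hence "Y = X + 2 * (v * w)" using hexagonal_sep[OF T XY(2) w(1)] by fastforce
  thus thesis using that w(2) by blast
qed

text \<open>Greedy descent: at distance at least 6/5 from \<open>s\<close>, the step to the best
  neighbour lowers the squared distance by more than 1/10, so induction on the number of tenths
  works. The covering radius \<open>2 / sqrt 3\<close> is just below 6/5.\<close>

lemma hexagonal_cover:
  assumes T: "hexagonal T" and ne: "T \<noteq> {}"
  obtains D where "D \<in> T" "norm (s - D) < 6/5"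
proof -
  have "\<exists>E\<in>T. norm (s - E) < 6/5" if "D \<in> T" "(norm (s - D))\<^sup>2 < 36/25 + real n / 10" for D n
    using that
  proof (induction n arbitrary: D)
    case 0
    hence "(norm (s - D))\<^sup>2 < (6/5)\<^sup>2" by (simp add: power2_eq_square)
    hence "norm (s - D) < 6/5" by (rule power2_less_imp_less) simp
    thus ?case using 0 by blast
  next
    case (Suc n)
    show ?case
    proof (cases "norm (s - D) < 6/5")
      case False
      obtain v where v: "norm v = 1" "D + 2 * v \<in> T" using T Suc.prems by (auto simp: hexagonal_def)
      obtain w where w: "D + 2 * (v * w) \<in> T" "norm (v * w) = 1"
        "(norm (s - (D + 2 * (v * w))))\<^sup>2 \<le> (norm (s - D))\<^sup>2 - 2 * sqrt 3 * norm (s - D) + 4"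
        by (rule hexagonal_towards[OF T Suc.prems(1) v, where z = s], rule that)
      have "173/100 * (6/5) \<le> sqrt 3 * norm (s - D)"
        using False sqrt_bounds(3) by (intro mult_mono; linarith)
      moreover have "(norm (s - D))\<^sup>2 < 36/25 + (real n + 1) / 10" using Suc.prems(2) by (simp add: add.commute)
      moreover have "b < 36/25 + m / 10" if "b \<le> a - 2 * q + 4" "173/100 * (6/5) \<le> q" "a < 36/25 + (m + 1) / 10"
        for a b q m :: real using that by argo
      ultimately have "(norm (s - (D + 2 * (v * w))))\<^sup>2 < 36/25 + real n / 10"
        using w(3) unfolding mult.assoc by blast
      thus ?thesis using Suc.IH w(1) by blast
    qed (use Suc in blast)
  qed
  moreover obtain D where D: "D \<in> T" using ne by blast
  moreover obtain n :: nat where "((norm (s - D))\<^sup>2) * 10 < real n" using reals_Archimedean2 by blast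
  hence "(norm (s - D))\<^sup>2 < 36/25 + real n / 10" by simp
  ultimately show thesis using that by blast
qed

text \<open>Being at least 2 away from all three corners and within 1.7 of the centroid confines a
  further point to a small neighbourhood of the centroid, where the corners are too close. The bound
  1.7 is chosen above \<open>sqrt 3 / 3 + 1.102\<close>, the reach needed in
  \<open>small_at_determined\<close>.\<close>

lemma near_hole_centre:
  assumes T: "hexagonal T" and X: "X \<in> T" and D: "D \<in> T" "D + 2 * u \<in> T" "norm u = 1"
    and near: "norm (X - hole_centre D u) < 1.7"
  shows "X = D \<or> X = D + 2 * u \<or> X = D + 2 * (u * zeta)"
proof (rule ccontr)
  assume no: "\<not> ?thesis"
  obtain z where z: "X = D + u * z" using frame_coords[OF D(3)] by blast
  \<comment> \<open>Coordinates about the centroid, the second rescaled so that the distance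
    conditions have rational coefficients.\<close>
  define a b where "a = Re z - 1" and "b = (Im z - sqrt 3 / 3) * (2 * sqrt 3 / 3)"
  have Im: "Im z = sqrt 3 / 3 + b * (sqrt 3 / 2)" by (simp add: b_def field_simps)
  have Re: "Re z = 1 + a" by (simp add: a_def)
  have Z: "D + 2 * (u * zeta) \<in> T" using hexagonal_rotate[OF T D(1) D(3) D(2)] by blast
  have "2 \<le> norm (z - 0)" "2 \<le> norm (z - 2)" "2 \<le> norm (z - 2 * zeta)"
    using hexagonal_sep[OF T X D(1)] hexagonal_sep[OF T X D(2)] hexagonal_sep[OF T X Z] no
      dist_frame[OF D(3), of D z 0] dist_frame[OF D(3), of D z 2] dist_frame[OF D(3), of D z "2 * zeta"]
    by (auto simp: z mult_ac)
  hence "2\<^sup>2 \<le> (norm (z - 0))\<^sup>2" "2\<^sup>2 \<le> (norm (z - 2))\<^sup>2" "2\<^sup>2 \<le> (norm (z - 2 * zeta))\<^sup>2"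
    by (intro power_mono; simp)+
  hence c: "8/3 \<le> a\<^sup>2 + 3/4 * b\<^sup>2 + 2 * a + b" "8/3 \<le> a\<^sup>2 + 3/4 * b\<^sup>2 - 2 * a + b" "8/3 \<le> a\<^sup>2 + 3/4 * b\<^sup>2 - 2 * b"
    unfolding norm_sq by (simp_all add: zeta_def Im Re power2_eq_square algebra_simps surd_simps)
  have "norm (z - Complex 1 (sqrt 3 / 3)) < 1.7"
    using near dist_frame[OF D(3), of D z "Complex 1 (sqrt 3 / 3)"] by (simp add: z dist_norm hole_centre_def)
  hence "(norm (z - Complex 1 (sqrt 3 / 3)))\<^sup>2 < 1.7\<^sup>2" by (intro power_strict_mono) auto
  hence S: "a\<^sup>2 + 3/4 * b\<^sup>2 < 289/100"
    unfolding norm_sq by (simp add: Im Re power2_eq_square algebra_simps surd_simps)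
  hence "\<bar>a\<bar> \<le> 1/5" "\<bar>b\<bar> \<le> 3/10" using c by linarith+
  hence "a\<^sup>2 \<le> (1/5)\<^sup>2" "b\<^sup>2 \<le> (3/10)\<^sup>2" by (simp_all only: abs_le_square_iff[symmetric] abs_divide abs_numeral)
  thus False using c(3) \<open>\<bar>b\<bar> \<le> 3/10\<close> by (simp add: power2_eq_square)
qed

text \<open>On the circle, being outside the three discs amounts to three linear inequalities. They
  describe the open triangle spanned by the points of tangency, which is inscribed in the circle and
  therefore lies strictly inside it.\<close>

lemma incircle_covered:
  assumes u: "norm u = 1" and x: "norm (x - hole_centre D u) = sqrt 3 / 3"
  shows "norm (x - D) \<le> 1 \<or> norm (x - (D + 2 * u)) \<le> 1 \<or> norm (x - (D + 2 * (u * zeta))) \<le> 1"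
proof (rule ccontr)
  assume no: "\<not> ?thesis"
  obtain z where z: "x = D + u * z" using frame_coords[OF u] by blast
  define a b where "a = Re z - 1" and "b = (Im z - sqrt 3 / 3) * (2 * sqrt 3 / 3)"
  have Im: "Im z = sqrt 3 / 3 + b * (sqrt 3 / 2)" by (simp add: b_def field_simps)
  have Re: "Re z = 1 + a" by (simp add: a_def)
  have "1 < norm (z - 0)" "1 < norm (z - 2)" "1 < norm (z - 2 * zeta)"
    using no dist_frame[OF u, of D z 0] dist_frame[OF u, of D z 2] dist_frame[OF u, of D z "2 * zeta"]
    by (auto simp: z mult_ac dist_norm)
  hence "1\<^sup>2 < (norm (z - 0))\<^sup>2" "1\<^sup>2 < (norm (z - 2))\<^sup>2" "1\<^sup>2 < (norm (z - 2 * zeta))\<^sup>2"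
    by (intro power_strict_mono; simp)+
  hence c: "- (1/3) < a\<^sup>2 + 3/4 * b\<^sup>2 + 2 * a + b" "- (1/3) < a\<^sup>2 + 3/4 * b\<^sup>2 - 2 * a + b" "- (1/3) < a\<^sup>2 + 3/4 * b\<^sup>2 - 2 * b"
    unfolding norm_sq by (simp_all add: zeta_def Im Re power2_eq_square algebra_simps surd_simps)
  have "norm (z - Complex 1 (sqrt 3 / 3)) = sqrt 3 / 3"
    using x dist_frame[OF u, of D z "Complex 1 (sqrt 3 / 3)"] by (simp add: z dist_norm hole_centre_def)
  hence "(norm (z - Complex 1 (sqrt 3 / 3)))\<^sup>2 = (sqrt 3 / 3)\<^sup>2" by simp
  hence S: "a\<^sup>2 + 3/4 * b\<^sup>2 = 1/3"
    unfolding norm_sq by (simp add: Im Re power2_eq_square algebra_simps surd_simps)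
  have b: "- (2/3) < b" "b < 1/3" and a: "\<bar>a\<bar> < 1/3 + b / 2" using c S by linarith+
  have "a\<^sup>2 < (1/3 + b / 2)\<^sup>2" using a b
    by (metis abs_ge_zero power2_abs power_strict_mono zero_less_numeral)
  moreover have "(b - 1/3) * (b + 2/3) < 0" using b by (intro mult_neg_pos) auto
  moreover have "(1/3 + b / 2)\<^sup>2 = 1/9 + b / 3 + b\<^sup>2 / 4" "(b - 1/3) * (b + 2/3) = b\<^sup>2 + b / 3 - 2/9"
    by (simp_all add: power2_eq_square field_simps)
  ultimately show False using S by linarith
qed

text \<open>Both ends of the side \<open>E\<close>, \<open>v\<close> are close enough to the
  centroid to be corners of the triangle. Of its six directed sides, the three clockwise ones put
  the small disc beyond the side, at distance \<open>sqrt 3 / 3 + (4 * sqrt 2 - 3 * sqrt 3)\<close>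
  from the centroid.\<close>

lemma small_at_determined:
  assumes T: "hexagonal T" and D: "D \<in> T" "D + 2 * u \<in> T" "norm u = 1"
    and E: "E \<in> T" "E + 2 * v \<in> T" "norm v = 1"
    and near: "norm (small_at E v - hole_centre D u) < sqrt 3 / 3"
  shows "(E = D \<and> v = u) \<or> (E = D + 2 * u \<and> v = u * (zeta - 1)) \<or>
    (E = D + 2 * (u * zeta) \<and> v = - (u * zeta))"
proof -
  let ?g = "hole_centre D u"
  have n: "norm (small_at E v - E) < 1.102" "norm (small_at E v - (E + 2 * v)) < 1.102"
  proof -
    have "small_at E v - E = v * apex" "small_at E v - (E + 2 * v) = v * (apex - 2)"
      by (simp_all add: small_at_def algebra_simps)
    thus "norm (small_at E v - E) < 1.102" "norm (small_at E v - (E + 2 * v)) < 1.102"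
      using norm_apex norm_apex_other sqrt_bounds by (simp_all add: norm_frame E(3))
  qed
  have "norm (X - ?g) < 1.7" if "norm (small_at E v - X) < 1.102" for X
    using norm_triangle_ineq4[of "small_at E v - ?g" "small_at E v - X"] that near sqrt_bounds by simp
  hence "norm (E - ?g) < 1.7" "norm (E + 2 * v - ?g) < 1.7" using n by blast+
  hence cases: "E = D \<or> E = D + 2 * u \<or> E = D + 2 * (u * zeta)"
    "E + 2 * v = D \<or> E + 2 * v = D + 2 * u \<or> E + 2 * v = D + 2 * (u * zeta)"
    using near_hole_centre[OF T _ D] E by blast+
  have far: "\<not> norm (u * z) < sqrt 3 / 3" if "sqrt 3 / 3 \<le> norm z" for z
    using that D(3) by (simp add: norm_mult)
  have v0: "v \<noteq> 0" using E(3) by auto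
  let ?c = "Complex 1 (sqrt 3 / 3)"
  have gt: "sqrt 3 / 3 \<le> norm z" if "norm z = sqrt 3 / 3 + (4 * sqrt 2 - 3 * sqrt 3)" for z
    using that sqrt_bounds by simp
  have "sqrt 3 / 3 \<le> norm (zeta * apex - ?c)" "sqrt 3 / 3 \<le> norm (2 - apex - ?c)"
    "sqrt 3 / 3 \<le> norm (2 * zeta + (1 - zeta) * apex - ?c)"
    by (rule gt, rule norm_eq_surd; use sqrt_bounds in \<open>simp add: zeta_def apex_def power2_eq_square algebra_simps surd_simps\<close>)+
  note outer = this[THEN far]
  show ?thesis
  proof (cases "E = D")
    case True
    hence "v = u \<or> v = u * zeta" using cases(2) v0 by auto
    moreover have "v \<noteq> u * zeta"
    proof
      assume v: "v = u * zeta"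
      hence "small_at E v - ?g = u * (zeta * apex - ?c)"
        unfolding v True small_at_def hole_centre_def by (simp add: algebra_simps)
      thus False using near outer(1) by simp
    qed
    ultimately show ?thesis using True by blast
  next
    case False
    show ?thesis
    proof (cases "E = D + 2 * u")
      case True
      hence "2 * v = 2 * (- u) \<or> 2 * v = 2 * (u * (zeta - 1))" using cases(2) v0 by (auto simp: algebra_simps eq_neg_iff_add_eq_0)
      hence "v = - u \<or> v = u * (zeta - 1)" by (metis mult_cancel_left zero_neq_numeral)
      moreover have "v \<noteq> - u"
      proof
        assume v: "v = - u"
        hence "small_at E v - ?g = u * (2 - apex - ?c)"
          unfolding v True small_at_def hole_centre_def by (simp add: algebra_simps)
        thus False using near outer(2) by simp
      qed
      ultimately show ?thesis using True by blast
    next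
      case notTrue: False
      hence Ez: "E = D + 2 * (u * zeta)" using cases(1) False by blast
      hence "2 * v = 2 * (u * (1 - zeta)) \<or> 2 * v = 2 * (- (u * zeta))" using cases(2) v0
        by (auto simp: algebra_simps eq_neg_iff_add_eq_0)
      hence "v = u * (1 - zeta) \<or> v = - (u * zeta)" by (metis mult_cancel_left zero_neq_numeral)
      moreover have "v \<noteq> u * (1 - zeta)"
      proof
        assume v: "v = u * (1 - zeta)"
        hence "small_at E v - ?g = u * (2 * zeta + (1 - zeta) * apex - ?c)"
          unfolding v Ez small_at_def hole_centre_def by (simp add: algebra_simps)
        thus False using near outer(3) by simp
      qed
      ultimately show ?thesis using Ez by blast
    qed
  qed
qed

subsection \<open>Triangular lattice packings and clusters\<close>

abbreviation unit_discs :: "complex set \<Rightarrow> disc set" where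
  "unit_discs T \<equiv> (\<lambda>c. (c, 1)) ` T"

lemma is_packing_unit_discs:
  "is_packing (unit_discs T) \<longleftrightarrow> (\<forall>D\<in>T. \<forall>E\<in>T. D \<noteq> E \<longrightarrow> 2 \<le> dist D E)"
  by (auto simp: is_packing_iff)

lemma cos_le_half:
  assumes "cos x \<le> 1/2" "0 \<le> x" "x < 2 * pi"
  shows "pi / 3 \<le> x" "x \<le> 5 * pi / 3"
proof -
  show "pi / 3 \<le> x"
  proof (rule ccontr)
    assume "\<not> pi / 3 \<le> x"
    hence "cos (pi / 3) < cos x" using assms by (intro cos_monotone_0_pi) auto
    thus False using assms by (simp add: cos_60)
  qed
  show "x \<le> 5 * pi / 3"
  proof (rule ccontr)
    assume "\<not> x \<le> 5 * pi / 3"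
    hence "cos (pi / 3) < cos (2 * pi - x)" using assms by (intro cos_monotone_0_pi) auto
    thus False using assms by (simp add: cos_60 cos_diff)
  qed
qed

lemma cos_gt_half:
  assumes "\<bar>x\<bar> < pi / 3"
  shows "cos x > 1/2"
proof -
  have "cos (pi / 3) < cos \<bar>x\<bar>" using assms by (intro cos_monotone_0_pi) auto
  thus ?thesis by (simp add: cos_60)
qed

lemma cis_minus_five_thirds: "cis (- (5 * pi / 3)) = zeta"
proof -
  have "- (5 * pi / 3) = pi / 3 - 2 * pi" by simp
  hence "cis (- (5 * pi / 3)) = cis (pi / 3 - 2 * pi)" by (rule arg_cong)
  also have "\<dots> = cis (pi / 3)" by (metis cis_2pi cis_divide div_by_1)
  finally show ?thesis by (simp add: complex_eq_iff zeta_def cos_60 sin_60)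
qed

text \<open>Clockwise from a given neighbour, the other five have directions in [60, 300] degrees, at
  pairwise distance at least 60 degrees; so one of them sits at 300 degrees, by the pigeonhole
  principle.\<close>

lemma six_neighbours_rotate:
  assumes pk: "is_packing (unit_discs T)" and D: "D \<in> T"
    and six: "card (neighbours (unit_discs T) (D, 1)) = 6"
    and u: "norm u = 1" "D + 2 * u \<in> T"
  shows "D + 2 * (u * zeta) \<in> T"
proof -
  let ?N = "neighbours (unit_discs T) (D, 1)"
  \<comment> \<open>The conjugation makes angles run clockwise from \<open>u\<close>, so the wanted
    neighbour, 60 degrees counterclockwise, appears at the upper end of the range.\<close>
  define y where "y E = cnj ((centre E - D) / (2 * u))" for E :: disc
  define \<theta> where "\<theta> E = Arg2pi (y E)" for E
  have u0: "u \<noteq> 0" using u by auto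
  have ny: "norm (y E) = 1" if "E \<in> ?N" for E
    using that u unfolding y_def complex_mod_cnj by (auto simp: neighbours_def tangent_def norm_divide norm_mult dist_norm norm_minus_commute)
  have cis: "y E = cis (\<theta> E)" if "E \<in> ?N" for E
    using polar[of "y E"] ny[OF that] by (simp add: \<theta>_def)
  have range: "0 \<le> \<theta> E" "\<theta> E < 2 * pi" for E
    by (auto simp: \<theta>_def Arg2pi_ge_0 Arg2pi_lt_2pi)
  have sep: "cos (\<theta> E - \<theta> F) \<le> 1/2" if EF: "E \<in> ?N" "F \<in> ?N" "E \<noteq> F" for E F
  proof -
    have "centre E \<in> T" "centre F \<in> T" "centre E \<noteq> centre F"
      using EF by (auto simp: neighbours_def)
    hence "2 \<le> norm (centre E - centre F)" using pk unfolding is_packing_unit_discs dist_norm by blast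
    also have "centre E - centre F = 2 * u * cnj (y E - y F)"
      using u0 by (simp add: y_def field_simps)
    finally have "1 \<le> norm (y E - y F)" using u by (simp add: norm_mult del: complex_cnj_diff)
    hence "1 \<le> (norm (y E - y F))\<^sup>2" by simp
    also have "\<dots> = 2 - 2 * cos (\<theta> E - \<theta> F)"
    proof -
      have "(cos (\<theta> E))\<^sup>2 + (sin (\<theta> E))\<^sup>2 = 1" "(cos (\<theta> F))\<^sup>2 + (sin (\<theta> F))\<^sup>2 = 1" by auto
      thus ?thesis unfolding norm_sq cis[OF EF(1)] cis[OF EF(2)]
        by (simp add: cos_diff power2_eq_square algebra_simps)
    qed
    finally show ?thesis by simp
  qed
  define E0 where "E0 = (D + 2 * u, 1 :: real)"
  have E0: "E0 \<in> ?N" using u u0 by (auto simp: E0_def neighbours_def tangent_def dist_norm norm_mult)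
  have "y E0 = 1" using u0 by (simp add: y_def E0_def)
  hence \<theta>0: "\<theta> E0 = 0" by (simp add: \<theta>_def Arg2pi_eq_0)
  have b: "pi / 3 \<le> \<theta> E" "\<theta> E \<le> 5 * pi / 3" if "E \<in> ?N - {E0}" for E
    using cos_le_half[of "\<theta> E"] sep[of E E0] that E0 range[of E] \<theta>0 by auto
  \<comment> \<open>The pigeonholes are angles in units of 60 degrees, rounded down. Five discs fill
    the values 1 to 5, and with the bound of 300 degrees the value 5 means exactly 300
    degrees.\<close>
  define \<phi> where "\<phi> E = \<lfloor>\<theta> E * 3 / pi\<rfloor>" for E
  have "inj_on \<phi> (?N - {E0})"
  proof (rule inj_onI, rule ccontr)
    fix E F assume EF: "E \<in> ?N - {E0}" "F \<in> ?N - {E0}" and eq: "\<phi> E = \<phi> F" and "E \<noteq> F"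
    have "\<bar>\<theta> E * 3 / pi - \<theta> F * 3 / pi\<bar> < 1"
      using eq unfolding \<phi>_def by linarith
    hence "\<bar>\<theta> E * 3 - \<theta> F * 3\<bar> < pi" by (simp add: field_simps flip: diff_divide_distrib)
    hence "\<bar>\<theta> E - \<theta> F\<bar> < pi / 3" by linarith
    hence "cos (\<theta> E - \<theta> F) > 1/2" by (rule cos_gt_half)
    thus False using sep[of E F] EF \<open>E \<noteq> F\<close> by auto
  qed
  hence "card (\<phi> ` (?N - {E0})) = 5"
    using six E0 by (simp add: card_image)
  moreover have "\<phi> ` (?N - {E0}) \<subseteq> {1..5}"
  proof
    fix k assume "k \<in> \<phi> ` (?N - {E0})"
    then obtain E where E: "E \<in> ?N - {E0}" "k = \<phi> E" by blast
    have "1 \<le> \<theta> E * 3 / pi" "\<theta> E * 3 / pi \<le> 5" using b[OF E(1)] by (simp_all add: field_simps)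
    thus "k \<in> {1..5}" unfolding E(2) \<phi>_def by (auto simp: le_floor_iff floor_le_iff)
  qed
  ultimately have "\<phi> ` (?N - {E0}) = {1..5}"
    by (intro card_subset_eq) auto
  hence "5 \<in> \<phi> ` (?N - {E0})" by simp
  then obtain E where E: "E \<in> ?N - {E0}" and "\<phi> E = 5" by (metis imageE)
  hence "5 \<le> \<theta> E * 3 / pi" unfolding \<phi>_def by linarith
  hence "\<theta> E = 5 * pi / 3" using b(2)[OF E] by (simp add: field_simps)
  hence "cis (- \<theta> E) = zeta" using cis_minus_five_thirds by metis
  hence "cnj (y E) = zeta" using cis[of E] E by (simp add: cis_cnj)
  hence "centre E = D + 2 * (u * zeta)" using u0 by (simp add: y_def field_simps)
  thus ?thesis using E by (auto simp: neighbours_def)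
qed

lemma double_half: "2 * (z / 2) = (z :: complex)"
  by simp

lemma triangular_imp_hexagonal:
  assumes "triangular_lattice_packing T"
  obtains A where "hexagonal A" "A \<noteq> {}" "T = unit_discs A"
proof
  define A where "A = centre ` T"
  show T: "T = unit_discs A"
    using assms by (force simp: triangular_lattice_packing_def A_def image_image)
  have pk: "is_packing (unit_discs A)" and ne: "T \<noteq> {}"
    and six: "\<And>D. D \<in> A \<Longrightarrow> card (neighbours (unit_discs A) (D, 1)) = 6"
    using assms unfolding triangular_lattice_packing_def T[symmetric] by (auto simp: T)
  show "A \<noteq> {}" using ne by (simp add: A_def)
  show "hexagonal A"
    unfolding hexagonal_def
  proof (intro conjI ballI)
    fix D assume D: "D \<in> A"
    have "neighbours (unit_discs A) (D, 1) \<noteq> {}" using six[OF D] by auto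
    then obtain c where c: "c \<in> A" "dist D c = 2" by (auto simp: neighbours_def tangent_def)
    moreover have "D + 2 * ((c - D) / 2) = c" by (simp only: double_half) simp
    ultimately have "norm ((c - D) / 2) = 1 \<and> D + 2 * ((c - D) / 2) \<in> A"
      by (simp only: norm_divide dist_norm norm_minus_commute[of D]) simp
    thus "\<exists>u. norm u = 1 \<and> D + 2 * u \<in> A" by blast
  qed (use pk six six_neighbours_rotate in \<open>auto simp: is_packing_unit_discs\<close>)
qed

lemma card_hexad: "card hexad = 6"
proof -
  have "distinct [1, zeta, zeta - 1, -1, - zeta, 1 - zeta]"
    by (simp add: zeta_def complex_eq_iff)
  from distinct_card[OF this] show ?thesis by simp
qed

text \<open>The neighbour of \<open>D\<close> within 30 degrees of the direction \<open>v\<close> is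
  less than 2 away from \<open>D + 2 * v\<close>, hence equal to it.\<close>

lemma hexagonal_unit_step:
  assumes T: "hexagonal T" and D: "D \<in> T" and u: "norm u = 1" "D + 2 * u \<in> T"
    and v: "norm v = 1" "D + 2 * v \<in> T"
  shows "\<exists>w\<in>hexad. v = u * w"
proof -
  obtain w where w: "w \<in> hexad" "D + 2 * (u * w) \<in> T" "norm (u * w) = 1"
    "(norm (D + 2 * v - (D + 2 * (u * w))))\<^sup>2 \<le> (norm (D + 2 * v - D))\<^sup>2 - 2 * sqrt 3 * norm (D + 2 * v - D) + 4"
    by (rule hexagonal_towards[OF T D u, where z = "D + 2 * v"], rule that)
  have "norm (D + 2 * v - D) = 2" using v by (simp add: norm_mult)
  hence "(dist (D + 2 * v) (D + 2 * (u * w)))\<^sup>2 < 2\<^sup>2"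
    using w(4) sqrt_bounds(3) unfolding dist_norm by simp
  hence "dist (D + 2 * v) (D + 2 * (u * w)) < 2" by (rule power2_less_imp_less) simp
  hence "D + 2 * v = D + 2 * (u * w)" using hexagonal_sep[OF T v(2) w(2)] by fastforce
  thus ?thesis using w(1) by auto
qed

lemma hexagonal_imp_triangular:
  assumes T: "hexagonal T" and ne: "T \<noteq> {}"
  shows "triangular_lattice_packing (unit_discs T)"
proof -
  have "card (neighbours (unit_discs T) (D, 1)) = 6" if D: "D \<in> T" for D
  proof -
    obtain u where u: "norm u = 1" "D + 2 * u \<in> T" using T D by (auto simp: hexagonal_def)
    have u0: "u \<noteq> 0" using u by auto
    have "neighbours (unit_discs T) (D, 1) = (\<lambda>w. (D + 2 * (u * w), 1 :: real)) ` hexad"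
    proof (intro equalityI subsetI)
      fix E assume "E \<in> neighbours (unit_discs T) (D, 1)"
      then obtain c where c: "E = (c, 1)" "c \<in> T" "norm (c - D) = 2"
        by (auto simp: neighbours_def tangent_def dist_norm norm_minus_commute)
      have "\<exists>w\<in>hexad. (c - D) / 2 = u * w"
        by (rule hexagonal_unit_step[OF T D u]) (simp_all only: double_half norm_divide c, simp_all add: c)
      then obtain w where "w \<in> hexad" "(c - D) / 2 = u * w" by blast
      hence "w \<in> hexad" "c = D + 2 * (u * w)" by (auto simp: field_simps)
      thus "E \<in> (\<lambda>w. (D + 2 * (u * w), 1 :: real)) ` hexad" using c(1) by blast
    next
      fix E assume "E \<in> (\<lambda>w. (D + 2 * (u * w), 1 :: real)) ` hexad"
      then obtain w where w: "w \<in> hexad" "E = (D + 2 * (u * w), 1)" by blast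
      hence "D + 2 * (u * w) \<in> T" "norm (u * w) = 1"
        using hexagonal_rotate[OF T D u] by blast+
      thus "E \<in> neighbours (unit_discs T) (D, 1)"
        unfolding w(2) by (auto simp: neighbours_def tangent_def dist_norm norm_mult)
    qed
    moreover have "inj_on (\<lambda>w. (D + 2 * (u * w), 1 :: real)) hexad"
      using u0 by (intro inj_onI) simp
    ultimately show ?thesis using card_hexad by (simp only: card_image)
  qed
  thus ?thesis
    using T ne unfolding triangular_lattice_packing_def is_packing_unit_discs
    by (auto simp: hexagonal_def)
qed

lemma hole_in_ball:
  assumes D: "D \<in> T" "D + 2 * u \<in> T" "D + 2 * (u * zeta) \<in> T" "norm u = 1"
    and H: "H \<in> holes (unit_discs T)" and x: "x \<in> H" "norm (x - hole_centre D u) < sqrt 3 / 3"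
  shows "H \<subseteq> ball (hole_centre D u) (sqrt 3 / 3)"
proof (rule ccontr)
  let ?B = "ball (hole_centre D u) (sqrt 3 / 3)"
  assume "\<not> H \<subseteq> ?B"
  hence "H - ?B \<noteq> {}" by blast
  moreover have "H \<inter> ?B \<noteq> {}" using x by (auto simp: dist_norm norm_minus_commute)
  moreover have "connected H" using H unfolding holes_def by (rule in_components_connected)
  ultimately have "H \<inter> frontier ?B \<noteq> {}" by (intro connected_Int_frontier) auto
  then obtain y where y: "y \<in> H" "norm (y - hole_centre D u) = sqrt 3 / 3"
    by (auto simp: dist_norm norm_minus_commute)
  have "H \<subseteq> - (\<Union>D\<in>unit_discs T. body D)"
    using H unfolding holes_def by (rule in_components_subset)
  hence "1 < norm (y - c)" if "c \<in> T" for c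
    using y(1) that by (force simp: body_def dist_norm norm_minus_commute)
  thus False using incircle_covered[OF D(4) y(2)] D by fastforce
qed

text \<open>The distances in a filled hole: \<open>6 - 2 * sqrt 6\<close> is \<open>1 + r\<close>
  and \<open>10 - 4 * sqrt 6\<close> is \<open>2 * r\<close>. The last two are those of a small disc
  from the centroid and from the corner it does not touch.\<close>

lemma norm_apexes:
  "norm apex3 = 6 - 2 * sqrt 6" "norm (apex3 - 2 * zeta) = 6 - 2 * sqrt 6"
  "norm (apex2 - 2) = 6 - 2 * sqrt 6" "norm (apex2 - 2 * zeta) = 6 - 2 * sqrt 6"
  "norm (apex - apex2) = 10 - 4 * sqrt 6" "norm (apex2 - apex3) = 10 - 4 * sqrt 6"
  "norm (apex - apex3) = 10 - 4 * sqrt 6"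
  "norm (apex - Complex 1 (sqrt 3 / 3)) = (10 * sqrt 3 - 12 * sqrt 2) / 3"
  "norm (2 * zeta - apex) = 4 * sqrt 3 - 4 * sqrt 2"
  by (rule norm_eq_surd; use sqrt_bounds in \<open>simp add: zeta_def apex_def apex2_def apex3_def power2_eq_square algebra_simps surd_simps\<close>)+

text \<open>The two solutions are mirror images in the line of centres; the second is the small disc
  of the reversed side.\<close>

lemma tangent_to_pair:
  assumes u: "norm u = 1" and "norm (x - D) = 6 - 2 * sqrt 6" "norm (x - (D + 2 * u)) = 6 - 2 * sqrt 6"
  shows "x = small_at D u \<or> x = small_at (D + 2 * u) (- u)"
proof -
  obtain z where z: "x = D + u * z" using frame_coords[OF u] by blast
  have "norm z = 6 - 2 * sqrt 6" "norm (z - 2) = 6 - 2 * sqrt 6"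
    using assms dist_frame[OF u, of D z 0] dist_frame[OF u, of D z 2] by (auto simp: z dist_norm mult_ac)
  hence sq: "(Re z)\<^sup>2 + (Im z)\<^sup>2 = (6 - 2 * sqrt 6)\<^sup>2" "(Re z - 2)\<^sup>2 + (Im z)\<^sup>2 = (6 - 2 * sqrt 6)\<^sup>2"
    using norm_sq[of z] norm_sq[of "z - 2"] by auto
  have 1: "Re z = 1" using sq by (simp add: power2_diff)
  have "(Im z)\<^sup>2 = (4 * sqrt 2 - 3 * sqrt 3)\<^sup>2"
    using sq(1) unfolding 1 by (simp add: power2_eq_square algebra_simps surd_simps)
  hence "Im z = 4 * sqrt 2 - 3 * sqrt 3 \<or> Im z = - (4 * sqrt 2 - 3 * sqrt 3)" by (simp add: power2_eq_iff)
  hence "z = apex \<or> z = 2 - apex" using 1 by (auto simp: apex_def complex_eq_iff)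
  moreover have "small_at (D + 2 * u) (- u) = D + u * (2 - apex)" by (simp add: small_at_def algebra_simps)
  ultimately show ?thesis unfolding z small_at_def by auto
qed

lemma small_near_hole_centre:
  assumes "norm u = 1"
  shows "norm (small_at D u - hole_centre D u) < sqrt 3 / 3"
    and "norm (D + u * apex2 - hole_centre D u) < sqrt 3 / 3"
    and "norm (D + u * apex3 - hole_centre D u) < sqrt 3 / 3"
proof -
  have *: "norm (small_at E v - hole_centre E v) < sqrt 3 / 3" if "norm v = 1" for E v
    using dist_frame[OF that, of E apex "Complex 1 (sqrt 3 / 3)"] norm_apexes(8) sqrt_bounds
    by (simp add: small_at_def hole_centre_def dist_norm)
  show "norm (small_at D u - hole_centre D u) < sqrt 3 / 3" using * assms by blast
  have z1: "norm (zeta - 1) = 1"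
    by (rule norm_eq_surd) (auto simp: zeta_def power2_eq_square)
  show "norm (D + u * apex2 - hole_centre D u) < sqrt 3 / 3"
    using *[of "u * (zeta - 1)" "D + 2 * u"] assms z1 by (simp add: small_at_turn hole_centre_turn norm_mult)
  show "norm (D + u * apex3 - hole_centre D u) < sqrt 3 / 3"
    using *[of "- (u * zeta)" "D + 2 * (u * zeta)"] assms by (simp add: small_at_turn hole_centre_turn norm_mult)
qed

text \<open>Each disc touches two unit discs whose centres are less than 3 apart, hence adjacent,
  and so sits at some directed side. Since all centres lie in one hole, hence in one incircle, only
  three positions are available, and the cluster has three discs.\<close>

lemma cluster_positions:
  assumes T: "hexagonal T" and H: "H \<in> holes (unit_discs T)" and r: "r = 5 - 2 * sqrt 6"
    and C: "is_cluster (unit_discs T) r H C"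
  obtains D u where "norm u = 1" "D \<in> T" "D + 2 * u \<in> T"
    "C = {(small_at D u, r), (D + u * apex2, r), (D + u * apex3, r)}"
proof -
  have r0: "r > 0" and r1: "1 + r = 6 - 2 * sqrt 6" "r + 1 = 6 - 2 * sqrt 6" using r sqrt_bounds by auto
  have card: "card C = 3" using C by (simp add: is_cluster_def)
  have pos: "\<exists>D u. norm u = 1 \<and> D \<in> T \<and> D + 2 * u \<in> T \<and> s = (small_at D u, r)" if s: "s \<in> C" for s
  proof -
    have rs: "radius s = r" using C s by (simp add: is_cluster_def)
    have "card {B \<in> bounding_discs (unit_discs T) H. tangent s B} = 2"
      using C s by (simp add: is_cluster_def)
    then obtain B B' where "{B \<in> bounding_discs (unit_discs T) H. tangent s B} = {B, B'}" "B \<noteq> B'"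
      by (auto simp: card_2_iff)
    hence B: "B \<in> unit_discs T" "B' \<in> unit_discs T" "tangent s B" "tangent s B'" "B \<noteq> B'"
      unfolding bounding_discs_def by auto
    obtain X Y where XY: "B = (X, 1)" "B' = (Y, 1)" and X: "X \<in> T" "Y \<in> T" using B by blast
    have d: "norm (centre s - X) = 6 - 2 * sqrt 6" "norm (centre s - Y) = 6 - 2 * sqrt 6"
      using B(3,4) XY rs r1 by (simp_all add: tangent_def dist_norm)
    have "X \<noteq> Y" using B(5) XY by blast
    have "dist X Y \<le> dist X (centre s) + dist (centre s) Y" by (rule dist_triangle)
    also have "\<dots> < 3" using d sqrt_bounds by (simp add: dist_norm norm_minus_commute)
    finally obtain u where u: "norm u = 1" "Y = X + 2 * u"
      using hexagonal_close[OF T X \<open>X \<noteq> Y\<close>] by blast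
    have "centre s = small_at X u \<or> centre s = small_at Y (- u)"
      using tangent_to_pair[OF u(1)] d u by blast
    moreover have "Y + 2 * (- u) = X" using u by simp
    ultimately show ?thesis using X u rs by (metis norm_minus_cancel prod.collapse)
  qed
  have "C \<noteq> {}" using card by auto
  then obtain s where s: "s \<in> C" by blast
  then obtain D u where Du: "norm u = 1" "D \<in> T" "D + 2 * u \<in> T" "s = (small_at D u, r)" using pos by blast
  have Z: "D + 2 * (u * zeta) \<in> T" using hexagonal_rotate[OF T Du(2) Du(1) Du(3)] by blast
  have inH: "centre s \<in> H" if "s \<in> C" for s
  proof -
    have "interior (body s) \<subseteq> H" "radius s = r" using C that by (auto simp: is_cluster_def)
    thus ?thesis using r0 by (auto simp: body_def)
  qed
  have sub: "H \<subseteq> ball (hole_centre D u) (sqrt 3 / 3)"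
    by (rule hole_in_ball[OF Du(2,3) Z Du(1) H inH[OF s]])
      (use small_near_hole_centre[OF Du(1)] Du(4) in simp)
  have "C \<subseteq> {(small_at D u, r), (D + u * apex2, r), (D + u * apex3, r)}"
  proof
    fix t assume t: "t \<in> C"
    obtain E v where Ev: "norm v = 1" "E \<in> T" "E + 2 * v \<in> T" "t = (small_at E v, r)" using pos[OF t] by blast
    have "norm (small_at E v - hole_centre D u) < sqrt 3 / 3"
      using inH[OF t] sub Ev(4) by (auto simp: dist_norm norm_minus_commute)
    from small_at_determined[OF T Du(2,3,1) Ev(2,3,1) this]
    show "t \<in> {(small_at D u, r), (D + u * apex2, r), (D + u * apex3, r)}"
      using Ev(4) by (auto simp: small_at_turn)
  qed
  moreover have "card {(small_at D u, r), (D + u * apex2, r), (D + u * apex3, r)} \<le> card C"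
    unfolding card by (simp add: card_insert_if)
  ultimately have "C = {(small_at D u, r), (D + u * apex2, r), (D + u * apex3, r)}"
    by (intro card_seteq) auto
  thus thesis using that Du by blast
qed

subsection \<open>Filling holes gives compact packings\<close>

lemma orient_frame:
  assumes "norm u = 1"
  shows "orient (D + u * a) (D + u * b) (D + u * c) = Im (cnj (b - a) * (c - a))"
proof -
  have "cnj (D + u * b - (D + u * a)) * (D + u * c - (D + u * a))
      = (u * cnj u) * (cnj (b - a) * (c - a))" by (simp add: algebra_simps)
  also have "u * cnj u = 1" using assms by (metis complex_norm_square of_real_1 one_power2)
  finally show ?thesis by (simp add: orient_def)
qed

lemma tangent_frame:
  assumes "norm u = 1"
  shows "tangent (D + u * a, s) (D + u * b, t) \<longleftrightarrow> norm (a - b) = s + t"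
  unfolding tangent_def fst_conv snd_conv dist_frame[OF assms] ..

text \<open>Seen from a unit disc at 0, the order is 2, \<open>apex\<close>, \<open>apex3\<close>,
  \<open>2 * zeta\<close>, and no unit or small disc from any sextant comes between consecutive
  ones. By the last claim only the small discs of the first sextant separate 2 from
  \<open>2 * zeta\<close>.\<close>

lemma sextant_order:
  assumes w: "w \<in> hexad" and g: "g \<in> {2 * w, w * apex, w * apex3}"
  shows "\<not> (0 < Im (cnj 2 * g) \<and> 0 < Im (cnj g * apex))"
    and "\<not> (0 < Im (cnj apex * g) \<and> 0 < Im (cnj g * apex3))"
    and "\<not> (0 < Im (cnj apex3 * g) \<and> 0 < Im (cnj g * (2 * zeta)))"
    and "0 < Im (cnj 2 * g) \<Longrightarrow> 0 < Im (cnj g * (2 * zeta)) \<Longrightarrow> w = 1 \<and> g \<noteq> 2 * w"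
proof -
  note defs = zeta_def apex_def apex3_def algebra_simps surd_simps
  show "\<not> (0 < Im (cnj 2 * g) \<and> 0 < Im (cnj g * apex))"
    using w g by (elim insertE emptyE; hypsubst) (use sqrt_bounds in \<open>simp_all add: defs\<close>)
  show "\<not> (0 < Im (cnj apex * g) \<and> 0 < Im (cnj g * apex3))"
    using w g by (elim insertE emptyE; hypsubst) (use sqrt_bounds in \<open>simp_all add: defs\<close>)
  show "\<not> (0 < Im (cnj apex3 * g) \<and> 0 < Im (cnj g * (2 * zeta)))"
    using w g by (elim insertE emptyE; hypsubst) (use sqrt_bounds in \<open>simp_all add: defs\<close>)
  have "apex \<noteq> 2" "apex3 \<noteq> 2" using sqrt_bounds by (auto simp: apex_def apex3_def complex_eq_iff)
  thus "w = 1 \<and> g \<noteq> 2 * w" if "0 < Im (cnj 2 * g)" "0 < Im (cnj g * (2 * zeta))"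
    using w g that by (elim insertE emptyE; hypsubst) (use sqrt_bounds in \<open>simp_all add: defs\<close>)
qed

text \<open>Seen from \<open>apex\<close>, the counterclockwise order is 0, 2, \<open>apex2\<close>,
  \<open>apex3\<close>: four left turns, and nothing in between.\<close>

lemma cluster_order:
  "0 < Im (cnj (0 - apex) * (2 - apex))" "0 < Im (cnj (2 - apex) * (apex2 - apex))"
  "0 < Im (cnj (apex2 - apex) * (apex3 - apex))" "0 < Im (cnj (apex3 - apex) * (0 - apex))"
  "g \<in> {0, 2, apex2, apex3} \<Longrightarrow> \<not> (0 < Im (cnj (0 - apex) * (g - apex)) \<and> 0 < Im (cnj (g - apex) * (2 - apex)))"
  "g \<in> {0, 2, apex2, apex3} \<Longrightarrow> \<not> (0 < Im (cnj (2 - apex) * (g - apex)) \<and> 0 < Im (cnj (g - apex) * (apex2 - apex)))"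
  "g \<in> {0, 2, apex2, apex3} \<Longrightarrow> \<not> (0 < Im (cnj (apex2 - apex) * (g - apex)) \<and> 0 < Im (cnj (g - apex) * (apex3 - apex)))"
  "g \<in> {0, 2, apex2, apex3} \<Longrightarrow> \<not> (0 < Im (cnj (apex3 - apex) * (g - apex)) \<and> 0 < Im (cnj (g - apex) * (0 - apex)))"
proof -
  note defs = apex_def apex2_def apex3_def algebra_simps surd_simps
  show "0 < Im (cnj (0 - apex) * (2 - apex))" "0 < Im (cnj (2 - apex) * (apex2 - apex))"
    "0 < Im (cnj (apex2 - apex) * (apex3 - apex))" "0 < Im (cnj (apex3 - apex) * (0 - apex))"
    using sqrt_bounds by (simp_all add: defs)
  assume g: "g \<in> {0, 2, apex2, apex3}"
  show "\<not> (0 < Im (cnj (0 - apex) * (g - apex)) \<and> 0 < Im (cnj (g - apex) * (2 - apex)))"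
    using g by (elim insertE emptyE; hypsubst) (use sqrt_bounds in \<open>simp_all add: defs\<close>)
  show "\<not> (0 < Im (cnj (2 - apex) * (g - apex)) \<and> 0 < Im (cnj (g - apex) * (apex2 - apex)))"
    using g by (elim insertE emptyE; hypsubst) (use sqrt_bounds in \<open>simp_all add: defs\<close>)
  show "\<not> (0 < Im (cnj (apex2 - apex) * (g - apex)) \<and> 0 < Im (cnj (g - apex) * (apex3 - apex)))"
    using g by (elim insertE emptyE; hypsubst) (use sqrt_bounds in \<open>simp_all add: defs\<close>)
  show "\<not> (0 < Im (cnj (apex3 - apex) * (g - apex)) \<and> 0 < Im (cnj (g - apex) * (0 - apex)))"
    using g by (elim insertE emptyE; hypsubst) (use sqrt_bounds in \<open>simp_all add: defs\<close>)
qed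

lemma small_hole_dist:
  assumes "norm u = 1"
  shows "norm (small_at D u - hole_centre D u) < 3/20"
proof -
  have "norm (apex - Complex 1 (sqrt 3 / 3)) < 3/20"
    unfolding norm_apexes(8) using sqrt_bounds by simp
  thus ?thesis using dist_frame[OF assms, of D apex "Complex 1 (sqrt 3 / 3)"]
    by (simp add: small_at_def hole_centre_def dist_norm)
qed

text \<open>Here \<open>filled\<close> marks directed sides, and \<open>turn\<close> says that the
  mark belongs to the hole: with one side all three are marked, so each cluster is complete. One
  direction of the theorem takes compactness from this locale, the other its distance
  estimates.\<close>

locale filled_lattice =
  fixes A :: "complex set" and filled :: "complex \<Rightarrow> complex \<Rightarrow> bool" and r :: real and P :: "disc set"
  assumes hex: "hexagonal A"
    and r: "r = 5 - 2 * sqrt 6"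
    and filledD: "filled D u \<Longrightarrow> D \<in> A \<and> D + 2 * u \<in> A \<and> norm u = 1"
    and turn: "filled D u \<Longrightarrow> filled (D + 2 * u) (u * (zeta - 1))"
    and P: "P = unit_discs A \<union> {(small_at D u, r) |D u. filled D u}"
begin

lemma r_simps: "r > 0" "1 + r = 6 - 2 * sqrt 6" "r + 1 = 6 - 2 * sqrt 6" "r + r = 10 - 4 * sqrt 6" "r \<noteq> 1" "r < 11/100"
  using r sqrt_bounds by auto

lemma turn2: "filled D u \<Longrightarrow> filled (D + 2 * (u * zeta)) (- (u * zeta))"
  using turn[OF turn, of D u] by (simp add: algebra_simps zeta_sq)

text \<open>A small disc is within 3/20 of the centroid, from which points other than the corners
  are at least 1.7 away; the third corner is at distance \<open>4 * sqrt 3 - 4 * sqrt 2\<close>,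
  also beyond \<open>1 + r\<close>.\<close>

lemma dist_big_small:
  assumes f: "filled D u" and X: "X \<in> A"
  shows "1 + r \<le> norm (X - small_at D u)"
    and "norm (X - small_at D u) = 1 + r \<Longrightarrow> X = D \<or> X = D + 2 * u"
proof -
  have u: "norm u = 1" using filledD[OF f] by blast
  have "1 + r \<le> norm (X - small_at D u) \<and> (norm (X - small_at D u) = 1 + r \<longrightarrow> X = D \<or> X = D + 2 * u)"
  proof (cases "X = D \<or> X = D + 2 * u \<or> X = D + 2 * (u * zeta)")
    case True
    have "norm (D - small_at D u) = 1 + r" "norm (D + 2 * u - small_at D u) = 1 + r"
      "norm (D + 2 * (u * zeta) - small_at D u) = 4 * sqrt 3 - 4 * sqrt 2"
      using dist_frame[OF u, of D 0 apex] dist_frame[OF u, of D 2 apex] dist_frame[OF u, of D "2 * zeta" apex]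
        norm_apex norm_apex_other norm_apexes(9) norm_minus_commute[of 2 apex] r_simps
      by (simp_all add: small_at_def dist_norm mult_ac)
    thus ?thesis using True sqrt_bounds r by auto
  next
    case False
    hence "17/10 \<le> norm (X - hole_centre D u)"
      using near_hole_centre[OF hex X, of D u] filledD[OF f] by force
    moreover have "norm (X - hole_centre D u) \<le> norm (X - small_at D u) + norm (small_at D u - hole_centre D u)"
      using norm_triangle_ineq[of "X - small_at D u" "small_at D u - hole_centre D u"] by simp
    ultimately have "1 + r < norm (X - small_at D u)" using small_hole_dist[OF u, of D] r_simps(6) by linarith
    thus ?thesis by simp
  qed
  thus "1 + r \<le> norm (X - small_at D u)"
    and "norm (X - small_at D u) = 1 + r \<Longrightarrow> X = D \<or> X = D + 2 * u" by auto
qed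

text \<open>A small disc centred inside the incircle belongs to the same cluster; one centred
  outside is at least \<open>sqrt 3 / 3 - 3/20\<close> away, more than \<open>2 * r\<close>.\<close>

lemma dist_small_small:
  assumes f: "filled D u" and g: "filled E v" and ne: "small_at E v \<noteq> small_at D u"
  shows "2 * r \<le> norm (small_at E v - small_at D u)"
    and "norm (small_at E v - small_at D u) = 2 * r \<Longrightarrow>
      small_at E v = D + u * apex2 \<or> small_at E v = D + u * apex3"
proof -
  have u: "norm u = 1" using filledD[OF f] by blast
  have "2 * r \<le> norm (small_at E v - small_at D u) \<and> (norm (small_at E v - small_at D u) = 2 * r \<longrightarrow>
      small_at E v = D + u * apex2 \<or> small_at E v = D + u * apex3)"
  proof (cases "norm (small_at E v - hole_centre D u) < sqrt 3 / 3")
    case True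
    have "(E = D \<and> v = u) \<or> (E = D + 2 * u \<and> v = u * (zeta - 1)) \<or> (E = D + 2 * (u * zeta) \<and> v = - (u * zeta))"
      by (rule small_at_determined[OF hex]) (use filledD[OF f] filledD[OF g] True in auto)
    hence *: "small_at E v = D + u * apex2 \<or> small_at E v = D + u * apex3"
      using ne by (auto simp: small_at_turn)
    have "norm (D + u * apex2 - small_at D u) = 2 * r" "norm (D + u * apex3 - small_at D u) = 2 * r"
      using dist_frame[OF u, of D apex2 apex] dist_frame[OF u, of D apex3 apex] r_simps
        norm_apexes norm_minus_commute[of apex2 apex] norm_minus_commute[of apex3 apex]
      by (simp_all add: small_at_def dist_norm)
    thus ?thesis using * by auto
  next
    case False
    have "norm (small_at E v - hole_centre D u)
        \<le> norm (small_at E v - small_at D u) + norm (small_at D u - hole_centre D u)"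
      using norm_triangle_ineq[of "small_at E v - small_at D u" "small_at D u - hole_centre D u"] by simp
    moreover have "1/2 < sqrt 3 / 3" using sqrt_bounds(3) by simp
    ultimately have "2 * r < norm (small_at E v - small_at D u)"
      using False small_hole_dist[OF u, of D] r_simps(6) by linarith
    thus ?thesis by simp
  qed
  thus "2 * r \<le> norm (small_at E v - small_at D u)"
    and "norm (small_at E v - small_at D u) = 2 * r \<Longrightarrow>
      small_at E v = D + u * apex2 \<or> small_at E v = D + u * apex3" by auto
qed

lemma packing: "is_packing P"
  unfolding is_packing_iff
proof (intro conjI ballI impI)
  fix E assume "E \<in> P" thus "radius E > 0" using r_simps unfolding P by auto
next
  fix E F assume EF: "E \<in> P" "F \<in> P" "E \<noteq> F"
  have bs: "radius E + radius F \<le> dist (centre E) (centre F)"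
    if "E \<in> unit_discs A" "filled D u" "F = (small_at D u, r)" for D u E F
    using that dist_big_small(1)[OF that(2)] by (auto simp: dist_norm)
  from EF consider "E \<in> unit_discs A" "F \<in> unit_discs A"
    | D u where "E \<in> unit_discs A" "filled D u" "F = (small_at D u, r)"
    | D u where "F \<in> unit_discs A" "filled D u" "E = (small_at D u, r)"
    | D u D' u' where "filled D u" "E = (small_at D u, r)" "filled D' u'" "F = (small_at D' u', r)"
    unfolding P by blast
  thus "radius E + radius F \<le> dist (centre E) (centre F)"
  proof cases
    case 1
    then obtain X Y where "E = (X, 1)" "F = (Y, 1)" "X \<in> A" "Y \<in> A" by blast
    thus ?thesis using hexagonal_sep[OF hex, of X Y] EF(3) by simp
  next
    case 2 thus ?thesis using bs by blast
  next
    case 3 thus ?thesis using bs by (metis add.commute dist_commute)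
  next
    case 4
    thus ?thesis using dist_small_small(1)[OF 4(3) 4(1)] EF(3) by (auto simp: dist_norm)
  qed
qed

lemma small_surrounded:
  assumes f: "filled D u"
  shows "surrounded P (small_at D u, r)"
proof (rule surroundedI[OF packing])
  let ?s = "(small_at D u, r)"
  have u: "norm u = 1" and A: "D \<in> A" "D + 2 * u \<in> A" using filledD[OF f] by auto
  show sP: "?s \<in> P" using f unfolding P by blast
  have s: "?s = (D + u * apex, r)" by (simp add: small_at_def)
  have P2: "(D + u * apex2, r) \<in> P" "(D + u * apex3, r) \<in> P"
    unfolding P using turn[OF f] turn2[OF f] small_at_turn[of D u] by (metis (mono_tags, lifting) UnI2 mem_Collect_eq)+
  have P1: "(D + u * 0, 1) \<in> P" "(D + u * 2, 1) \<in> P" using A unfolding P by (auto simp: mult.commute)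
  have ne: "apex2 \<noteq> apex" "apex3 \<noteq> apex"
    using norm_apexes(5,7) r_simps by auto
  have "u \<noteq> 0" using u by auto
  have N: "neighbours P ?s = {(D + u * 0, 1), (D + u * 2, 1), (D + u * apex2, r), (D + u * apex3, r)}"
  proof (intro equalityI subsetI)
    fix E assume E: "E \<in> neighbours P ?s"
    hence EP: "E \<in> P" "E \<noteq> ?s" "tangent ?s E" by (auto simp: neighbours_def)
    from EP(1) consider X where "X \<in> A" "E = (X, 1)" | F v where "filled F v" "E = (small_at F v, r)"
      unfolding P by blast
    thus "E \<in> {(D + u * 0, 1), (D + u * 2, 1), (D + u * apex2, r), (D + u * apex3, r)}"
    proof cases
      case 1
      hence "norm (X - small_at D u) = 1 + r" using EP(3) by (simp add: tangent_def dist_norm norm_minus_commute)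
      thus ?thesis using dist_big_small(2)[OF f 1(1)] 1(2) by (auto simp: mult.commute)
    next
      case 2
      hence "norm (small_at F v - small_at D u) = 2 * r" using EP(3) by (simp add: tangent_def dist_norm norm_minus_commute)
      moreover have "small_at F v \<noteq> small_at D u" using 2 EP(2) by auto
      ultimately show ?thesis using dist_small_small(2)[OF f 2(1)] 2(2) by auto
    qed
  next
    fix E assume "E \<in> {(D + u * 0, 1), (D + u * 2, 1), (D + u * apex2, r), (D + u * apex3, r)}"
    thus "E \<in> neighbours P ?s"
      using P1 P2 ne \<open>u \<noteq> 0\<close> r_simps norm_apex norm_apex_other norm_apexes
      unfolding neighbours_def s mem_Collect_eq by (auto simp only: tangent_frame[OF u]) auto
  qed
  show "finite (neighbours P ?s)" "neighbours P ?s \<noteq> {}" unfolding N by auto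
  have step: "\<exists>F\<in>neighbours P ?s. tangent (D + u * a, x) F \<and>
      orient (centre ?s) (centre (D + u * a, x)) (centre F) > 0 \<and>
      (\<forall>G\<in>neighbours P ?s. \<not> (orient (centre ?s) (centre (D + u * a, x)) (centre G) > 0 \<and>
                                 orient (centre ?s) (centre G) (centre F) > 0))"
    if "(D + u * b, y) \<in> neighbours P ?s" "norm (a - b) = x + y"
      "0 < Im (cnj (a - apex) * (b - apex))"
      "\<And>g. g \<in> {0, 2, apex2, apex3} \<Longrightarrow>
        \<not> (0 < Im (cnj (a - apex) * (g - apex)) \<and> 0 < Im (cnj (g - apex) * (b - apex)))" for a b x y
  proof (intro bexI[OF _ that(1)] conjI ballI)
    show "tangent (D + u * a, x) (D + u * b, y)" using that(2) by (simp add: tangent_frame[OF u])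
    show "orient (centre ?s) (centre (D + u * a, x)) (centre (D + u * b, y)) > 0"
      unfolding s fst_conv orient_frame[OF u] by (rule that(3))
    fix G assume "G \<in> neighbours P ?s"
    then obtain g where g: "g \<in> {0, 2, apex2, apex3}" "centre G = D + u * g" unfolding N by force
    show "\<not> (orient (centre ?s) (centre (D + u * a, x)) (centre G) > 0 \<and>
                orient (centre ?s) (centre G) (centre (D + u * b, y)) > 0)"
      unfolding s g(2) fst_conv orient_frame[OF u] by (rule that(4)[OF g(1)])
  qed
  fix E assume "E \<in> neighbours P ?s"
  then consider "E = (D + u * 0, 1)" | "E = (D + u * 2, 1)" | "E = (D + u * apex2, r)" | "E = (D + u * apex3, r)"
    unfolding N by blast
  thus "\<exists>F\<in>neighbours P ?s. tangent E F \<and> orient (centre ?s) (centre E) (centre F) > 0 \<and>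
      (\<forall>G\<in>neighbours P ?s. \<not> (orient (centre ?s) (centre E) (centre G) > 0 \<and>
                                 orient (centre ?s) (centre G) (centre F) > 0))"
  proof cases
    case 1 show ?thesis unfolding 1
      by (rule step[of 2 1]) (simp add: N, simp, rule cluster_order, erule cluster_order)
  next
    case 2 show ?thesis unfolding 2
      by (rule step[of apex2 r])
        (simp add: N, simp add: norm_minus_commute[of 2] norm_apexes r_simps, rule cluster_order, erule cluster_order)
  next
    case 3 show ?thesis unfolding 3
      by (rule step[of apex3 r])
        (simp add: N, simp add: norm_apexes r_simps, rule cluster_order, erule cluster_order)
  next
    case 4 show ?thesis unfolding 4
      by (rule step[of 0 1])
        (simp add: N, simp add: norm_apexes r_simps, rule cluster_order, erule cluster_order)
  qed
qed

lemma big_neighbours: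
  assumes D: "D \<in> A" and u: "norm u = 1" "D + 2 * u \<in> A"
  shows "E \<in> neighbours P (D, 1) \<longleftrightarrow> (\<exists>w\<in>hexad. E = (D + u * (2 * w), 1) \<or>
    filled D (u * w) \<and> (E = (D + u * (w * apex), r) \<or> E = (D + u * (w * apex3), r)))"
    (is "_ \<longleftrightarrow> ?R")
proof
  assume "E \<in> neighbours P (D, 1)"
  hence E: "E \<in> P" "E \<noteq> (D, 1)" "tangent (D, 1) E" by (auto simp: neighbours_def)
  from E(1) consider X where "X \<in> A" "E = (X, 1)" | F v where "filled F v" "E = (small_at F v, r)"
    unfolding P by blast
  thus ?R
  proof cases
    case 1
    hence "norm (X - D) = 2" using E(3) by (simp add: tangent_def dist_norm norm_minus_commute)
    hence "norm ((X - D) / 2) = 1" by (simp only: norm_divide) simp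
    moreover have X: "D + 2 * ((X - D) / 2) = X" by (simp only: double_half) simp
    ultimately have "\<exists>w\<in>hexad. (X - D) / 2 = u * w"
      using hexagonal_unit_step[OF hex D u] 1(1) by metis
    then obtain w where "w \<in> hexad" "(X - D) / 2 = u * w" by blast
    hence "X = D + u * (2 * w)" using X by (simp add: mult.left_commute)
    thus ?thesis using 1(2) \<open>w \<in> hexad\<close> by blast
  next
    case 2
    have fd: "F \<in> A" "F + 2 * v \<in> A" "norm v = 1" using filledD[OF 2(1)] by auto
    have "norm (D - small_at F v) = 1 + r" using E(3) 2(2) by (simp add: tangent_def dist_norm)
    from dist_big_small(2)[OF 2(1) D this] show ?thesis
    proof
      assume DF: "D = F"
      obtain w where w: "w \<in> hexad" "v = u * w"
        using hexagonal_unit_step[OF hex D u fd(3)] fd(2) DF by blast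
      have "E = (D + u * (w * apex), r)" using 2(2) w(2) DF by (simp add: small_at_def mult.assoc)
      thus ?thesis using w 2(1) DF by blast
    next
      assume DF: "D = F + 2 * v"
      \<comment> \<open>\<open>D\<close> is the end of the side here. The side that starts at
        \<open>D\<close> addresses the same hole, with the disc in the position
        \<open>apex3\<close>.\<close>
      define v' where "v' = v * (zeta - 1)"
      have f': "filled D v'" using turn[OF 2(1)] DF by (simp add: v'_def)
      have v'z: "v' * zeta = - v" by (simp add: v'_def algebra_simps zeta_sq)
      have "small_at (D + 2 * (v' * zeta)) (- (v' * zeta)) = D + v' * apex3" by (rule small_at_turn)
      hence s: "small_at F v = D + v' * apex3" unfolding v'z using DF by simp
      obtain w where w: "w \<in> hexad" "v' = u * w"
        using hexagonal_unit_step[OF hex D u, of v'] filledD[OF f'] by blast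
      have "E = (D + u * (w * apex3), r)" using 2(2) w(2) s by (simp add: mult.assoc)
      thus ?thesis using w f' by blast
    qed
  qed
next
  assume ?R
  then obtain w where w: "w \<in> hexad" and
    E: "E = (D + u * (2 * w), 1) \<or> filled D (u * w) \<and> (E = (D + u * (w * apex), r) \<or> E = (D + u * (w * apex3), r))"
    by blast
  define v where "v = u * w"
  have v: "D + 2 * v \<in> A" "norm v = 1" using hexagonal_rotate[OF hex D u] w unfolding v_def by blast+
  have v0: "v \<noteq> 0" using v by auto
  from E consider "E = (D + v * 2, 1)" | "filled D v" "E = (D + v * apex, r)" | "filled D v" "E = (D + v * apex3, r)"
    unfolding v_def by (auto simp: mult_ac)
  thus "E \<in> neighbours P (D, 1)"
  proof cases
    case 1
    hence "E \<in> P" using v unfolding P by (auto simp: mult.commute)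
    moreover have "tangent (D + v * 0, 1) E" unfolding 1 tangent_frame[OF v(2)] by simp
    ultimately show ?thesis using v0 1 by (simp add: neighbours_def)
  next
    case 2
    hence "E \<in> P" unfolding P by (auto simp: small_at_def)
    moreover have "tangent (D + v * 0, 1) E" unfolding 2 tangent_frame[OF v(2)] by (simp add: norm_apex r_simps)
    ultimately show ?thesis using r_simps 2 by (simp add: neighbours_def)
  next
    case 3
    hence "E \<in> P" unfolding P using turn2[OF 3(1)] small_at_turn(2)[of D v, symmetric] by auto
    moreover have "tangent (D + v * 0, 1) E" unfolding 3 tangent_frame[OF v(2)] by (simp add: norm_apexes r_simps)
    ultimately show ?thesis using r_simps 3 by (simp add: neighbours_def)
  qed
qed

text \<open>Rotating the frame brings the neighbour \<open>E\<close> into the first sextant. The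
  next neighbour is then the unit disc at \<open>2 * zeta\<close> or, if the hole is filled and not
  yet passed, the next small disc in it.\<close>

lemma big_surrounded:
  assumes D: "D \<in> A"
  shows "surrounded P (D, 1)"
proof (rule surroundedI[OF packing])
  let ?N = "neighbours P (D, 1)"
  show "(D, 1) \<in> P" using D unfolding P by blast
  obtain u where u: "norm u = 1" "D + 2 * u \<in> A" using hex D by (auto simp: hexagonal_def)
  have "?N \<subseteq> (\<Union>w\<in>hexad. {(D + u * (2 * w), 1), (D + u * (w * apex), r), (D + u * (w * apex3), r)})"
    using big_neighbours[OF D u] by blast
  thus "finite ?N" by (rule finite_subset) auto
  show "?N \<noteq> {}" using big_neighbours[OF D u] by blast
  fix E assume "E \<in> ?N"
  then obtain w where w: "w \<in> hexad" and
    E: "E = (D + u * (2 * w), 1) \<or> filled D (u * w) \<and> (E = (D + u * (w * apex), r) \<or> E = (D + u * (w * apex3), r))"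
    using big_neighbours[OF D u] by blast
  define v where "v = u * w"
  have v: "norm v = 1" "D + 2 * v \<in> A" using hexagonal_rotate[OF hex D u] w unfolding v_def by blast+
  have Nv: "E \<in> ?N \<longleftrightarrow> (\<exists>w\<in>hexad. E = (D + v * (2 * w), 1) \<or>
    filled D (v * w) \<and> (E = (D + v * (w * apex), r) \<or> E = (D + v * (w * apex3), r)))" for E
    by (rule big_neighbours[OF D v])
  have centre_G: "\<exists>w\<in>hexad. \<exists>g\<in>{2 * w, w * apex, w * apex3}. centre G = D + v * g \<and> (g = 2 * w \<or> filled D (v * w))"
    if "G \<in> ?N" for G
    using that unfolding Nv by fastforce
  have step: "\<exists>F\<in>?N. tangent (D + v * a, x) F \<and>
      orient (centre (D, 1)) (centre (D + v * a, x)) (centre F) > 0 \<and>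
      (\<forall>G\<in>?N. \<not> (orient (centre (D, 1)) (centre (D + v * a, x)) (centre G) > 0 \<and>
                    orient (centre (D, 1)) (centre G) (centre F) > 0))"
    if "(D + v * b, y) \<in> ?N" "norm (a - b) = x + y" "0 < Im (cnj a * b)"
      "\<And>w g. w \<in> hexad \<Longrightarrow> g \<in> {2 * w, w * apex, w * apex3} \<Longrightarrow> g = 2 * w \<or> filled D (v * w) \<Longrightarrow>
        \<not> (0 < Im (cnj a * g) \<and> 0 < Im (cnj g * b))" for a b x y
  proof (intro bexI[OF _ that(1)] conjI ballI)
    have o: "orient D (D + v * c) (D + v * d) = Im (cnj c * d)" for c d
      using orient_frame[OF v(1), of D 0 c d] by simp
    show "tangent (D + v * a, x) (D + v * b, y)" using that(2) by (simp add: tangent_frame[OF v(1)])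
    show "orient (centre (D, 1)) (centre (D + v * a, x)) (centre (D + v * b, y)) > 0"
      unfolding fst_conv o by (rule that(3))
    fix G assume "G \<in> ?N"
    then obtain w g where g: "w \<in> hexad" "g \<in> {2 * w, w * apex, w * apex3}" "g = 2 * w \<or> filled D (v * w)"
      "centre G = D + v * g" using centre_G by blast
    show "\<not> (orient (centre (D, 1)) (centre (D + v * a, x)) (centre G) > 0 \<and>
                orient (centre (D, 1)) (centre G) (centre (D + v * b, y)) > 0)"
      unfolding g(4) fst_conv o by (rule that(4)[OF g(1,2,3)])
  qed
  have big1: "(D + v * (2 * zeta), 1) \<in> ?N" unfolding Nv by blast
  have small1: "(D + v * apex, r) \<in> ?N" "(D + v * apex3, r) \<in> ?N" if "filled D v"
    unfolding Nv using that by (auto intro!: bexI[of _ 1])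
  have pos: "0 < Im (cnj 2 * (2 * zeta))" "0 < Im (cnj 2 * apex)" "0 < Im (cnj apex * apex3)" "0 < Im (cnj apex3 * (2 * zeta))"
    using sqrt_bounds by (simp_all add: zeta_def apex_def apex3_def algebra_simps surd_simps)
  from E consider "E = (D + v * 2, 1)" "\<not> filled D v" | "E = (D + v * 2, 1)" "filled D v"
    | "filled D v" "E = (D + v * apex, r)" | "filled D v" "E = (D + v * apex3, r)"
    unfolding v_def by (auto simp: mult_ac)
  thus "\<exists>F\<in>?N. tangent E F \<and> orient (centre (D, 1)) (centre E) (centre F) > 0 \<and>
      (\<forall>G\<in>?N. \<not> (orient (centre (D, 1)) (centre E) (centre G) > 0 \<and>
                    orient (centre (D, 1)) (centre G) (centre F) > 0))"
  proof cases
    case 1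
    show ?thesis unfolding 1(1)
    proof (rule step[OF big1 _ pos(1)])
      have "2 - 2 * zeta = - (2 * (zeta - 1))" by simp
      hence "norm (2 - 2 * zeta) = 2 * norm (zeta - 1)" by (simp only: norm_minus_cancel norm_mult) simp
      moreover have "norm (zeta - 1) = 1" by (rule norm_eq_surd) (auto simp: zeta_def power2_eq_square)
      ultimately show "norm (2 - 2 * zeta) = 1 + (1::real)" by simp
      fix w g assume wg: "w \<in> hexad" "g \<in> {2 * w, w * apex, w * apex3}" "g = 2 * w \<or> filled D (v * w)"
      show "\<not> (0 < Im (cnj 2 * g) \<and> 0 < Im (cnj g * (2 * zeta)))"
        using sextant_order(4)[OF wg(1,2)] wg(3) 1(2) by auto
    qed
  next
    case 2
    show ?thesis unfolding 2(1)
      by (rule step[OF small1(1)[OF 2(2)] _ pos(2)])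
        (simp add: norm_minus_commute[of 2] norm_apex_other r_simps, rule sextant_order)
  next
    case 3
    show ?thesis unfolding 3(2)
      by (rule step[OF small1(2)[OF 3(1)] _ pos(3)])
        (simp add: norm_apexes r_simps, rule sextant_order)
  next
    case 4
    show ?thesis unfolding 4(2)
      by (rule step[OF big1 _ pos(4)])
        (simp add: norm_apexes r_simps, rule sextant_order)
  qed
qed

lemma compact: "compact_packing P"
  unfolding compact_packing_def using packing big_surrounded small_surrounded P by auto

end

text \<open>A side counts as filled when the small disc at it is present. That disc lies in a
  cluster, and clusters occupy all three positions of a triangle, which gives
  \<open>turn\<close>.\<close>

lemma compact_packing_of_clusters:
  assumes r: "r = 5 - 2 * sqrt 6" and T: "triangular_lattice_packing T"
    and S: "S \<subseteq> holes T" "S \<noteq> {}" and C: "\<forall>H\<in>S. is_cluster T r H (C H)"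
  shows "compact_packing_using 1 r (T \<union> (\<Union>H\<in>S. C H))"
proof -
  obtain A where A: "hexagonal A" "A \<noteq> {}" "T = unit_discs A"
    using triangular_imp_hexagonal[OF T] by blast
  let ?smalls = "\<Union>H\<in>S. C H"
  define filled where "filled D u \<longleftrightarrow> D \<in> A \<and> D + 2 * u \<in> A \<and> norm u = 1 \<and> (small_at D u, r) \<in> ?smalls" for D u
  have pos: "\<exists>D u. norm u = 1 \<and> D \<in> A \<and> D + 2 * u \<in> A \<and> C H = {(small_at D u, r), (D + u * apex2, r), (D + u * apex3, r)}"
    if "H \<in> S" for H
  proof -
    have "H \<in> holes (unit_discs A)" "is_cluster (unit_discs A) r H (C H)"
      using that S(1) C A(3) by auto
    thus ?thesis by (rule cluster_positions[OF A(1) _ r]) (intro exI conjI)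
  qed
  have orbit: "filled D u" "filled (D + 2 * u) (u * (zeta - 1))" "filled (D + 2 * (u * zeta)) (- (u * zeta))"
    if Du: "norm u = 1" "D \<in> A" "D + 2 * u \<in> A"
      and sub: "{(small_at D u, r), (D + u * apex2, r), (D + u * apex3, r)} \<subseteq> ?smalls" for D u
  proof -
    have Z: "D + 2 * (u * zeta) \<in> A" using hexagonal_rotate[OF A(1) Du(2,1,3)] by blast
    have n: "norm (u * (zeta - 1)) = 1" using hexagonal_rotate[OF A(1) Du(2,1,3)] by blast
    have e: "D + 2 * u + 2 * (u * (zeta - 1)) = D + 2 * (u * zeta)" by (simp add: algebra_simps)
    show "filled D u" "filled (D + 2 * u) (u * (zeta - 1))" "filled (D + 2 * (u * zeta)) (- (u * zeta))"
      using Du sub Z n unfolding filled_def small_at_turn e by (auto simp: norm_mult)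
  qed
  interpret filled_lattice A filled r "T \<union> ?smalls"
  proof
    show "hexagonal A" "r = 5 - 2 * sqrt 6" by fact+
    show "filled D u \<Longrightarrow> D \<in> A \<and> D + 2 * u \<in> A \<and> norm u = 1" for D u by (simp add: filled_def)
    fix D u assume f: "filled D u"
    then obtain H where H: "H \<in> S" "(small_at D u, r) \<in> C H" by (auto simp: filled_def)
    obtain E v where Ev: "norm v = 1" "E \<in> A" "E + 2 * v \<in> A"
      "C H = {(small_at E v, r), (E + v * apex2, r), (E + v * apex3, r)}" using pos[OF H(1)] by blast
    \<comment> \<open>The cluster containing the disc is addressed by some side \<open>E\<close>,
      \<open>v\<close>; hence \<open>D\<close>, \<open>u\<close> is one of the three directed sides
      of the same triangle, and \<open>orbit\<close> covers its successor.\<close>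
    have "norm (small_at D u - hole_centre E v) < sqrt 3 / 3"
      using H(2) small_near_hole_centre[OF Ev(1)] unfolding Ev(4) by auto
    hence "(D = E \<and> u = v) \<or> (D = E + 2 * v \<and> u = v * (zeta - 1)) \<or> (D = E + 2 * (v * zeta) \<and> u = - (v * zeta))"
      by (intro small_at_determined[OF A(1)]) (use f Ev in \<open>auto simp: filled_def\<close>)
    moreover have "{(small_at E v, r), (E + v * apex2, r), (E + v * apex3, r)} \<subseteq> ?smalls"
      using H(1) Ev(4) by blast
    note o = orbit[OF Ev(1-3) this]
    have "E + 2 * v + 2 * (v * (zeta - 1)) = E + 2 * (v * zeta)" "v * (zeta - 1) * (zeta - 1) = - (v * zeta)"
      "E + 2 * (v * zeta) + 2 * (- (v * zeta)) = E" "- (v * zeta) * (zeta - 1) = v"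
      by (simp_all add: algebra_simps zeta_sq)
    ultimately show "filled (D + 2 * u) (u * (zeta - 1))" using o by metis
  next
    have "?smalls = {(small_at D u, r) |D u. filled D u}"
    proof (intro equalityI subsetI)
      fix s assume "s \<in> ?smalls"
      then obtain H where H: "H \<in> S" "s \<in> C H" by blast
      obtain E v where Ev: "norm v = 1" "E \<in> A" "E + 2 * v \<in> A"
        "C H = {(small_at E v, r), (E + v * apex2, r), (E + v * apex3, r)}" using pos[OF H(1)] by blast
      have "{(small_at E v, r), (E + v * apex2, r), (E + v * apex3, r)} \<subseteq> ?smalls"
        using H(1) Ev(4) by blast
      note o = orbit[OF Ev(1-3) this]
      show "s \<in> {(small_at D u, r) |D u. filled D u}"
        using H(2) o unfolding Ev(4) small_at_turn[symmetric] by blast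
    qed (auto simp: filled_def)
    thus "T \<union> ?smalls = unit_discs A \<union> {(small_at D u, r) |D u. filled D u}" using A(3) by simp
  qed
  obtain H where H: "H \<in> S" using S(2) by blast
  obtain s where s: "s \<in> ?smalls" using pos[OF H] H by blast
  have rad: "radius s = r" if "s \<in> ?smalls" for s using that C by (auto simp: is_cluster_def)
  have "radius ` ?smalls = {r}"
  proof (intro equalityI subsetI)
    fix x assume "x \<in> radius ` ?smalls"
    thus "x \<in> {r}" using rad by (elim imageE) (simp del: UN_iff)
  next
    fix x assume "x \<in> {r}"
    thus "x \<in> radius ` ?smalls" using rad[OF s] s by (metis imageI singletonD)
  qed
  moreover have "radius ` T = {1}" using A(2) unfolding A(3) image_image by auto
  ultimately show ?thesis using compact unfolding compact_packing_using_def by (simp add: image_Un insert_commute)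
qed

subsection \<open>The corona of a small disc\<close>

text \<open>
  Rotations by the angle at the centre of a small disc between two tangent neighbours: both large
  (rot_bb), or one large and one small (rot_bs). For two small neighbours the rotation is zeta.
\<close>

definition rot_bb :: complex where "rot_bb = Complex (1/6 - sqrt 6 / 3) ((sqrt 3 + 2 * sqrt 2) / 6)"
definition rot_bs :: complex where "rot_bs = Complex (1/2 - sqrt 6 / 6) ((sqrt 3 + 3 * sqrt 2) / 6)"

lemma surd_mult_numeral:
  "sqrt 2 * (numeral k * x) = numeral k * (sqrt 2 * x)"
  "sqrt 3 * (numeral k * x) = numeral k * (sqrt 3 * x)"
  "sqrt 6 * (numeral k * x) = numeral k * (sqrt 6 * x)"
  "sqrt 2 * numeral k = numeral k * sqrt 2"
  "sqrt 3 * numeral k = numeral k * sqrt 3"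
  "sqrt 6 * numeral k = numeral k * sqrt 6"
  by (simp_all add: mult.left_commute)

lemmas rot_defs = rot_bb_def rot_bs_def zeta_def
lemmas rot_arith = mult.assoc surd_simps surd_mult_numeral distrib_left distrib_right left_diff_distrib right_diff_distrib
  add_divide_distrib diff_divide_distrib

text \<open>Side ratios of the triangles of tangent centres: \<open>1 + sqrt 6 / 3\<close> is
  \<open>2 / (1 + r)\<close>, \<open>1 - sqrt 6 / 3\<close> is \<open>2 * r / (1 + r)\<close>, and
  \<open>3 + sqrt 6\<close> is the inverse of the latter.\<close>

lemma rot_norms:
  "norm rot_bb = 1" "norm (rot_bb - 1) = 1 + sqrt 6 / 3" "norm rot_bs = 1"
  "norm (of_real (1 - sqrt 6 / 3) * rot_bs - 1) = 1"
  "norm (of_real (3 + sqrt 6) * rot_bs - 1) = 3 + sqrt 6" "norm (zeta - 1) = 1"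
  by (rule norm_eq_surd; use sqrt_bounds in \<open>simp add: rot_defs power2_eq_square rot_arith\<close>)+

text \<open>The four angles of the corona make a full turn; this is the relation that singles out
  the radius.\<close>

lemma rot_product: "rot_bs * zeta * rot_bs * rot_bb = 1"
  by (simp add: rot_defs complex_eq_iff rot_arith)

text \<open>The change from directions at the small disc to the frame of the side joining its two
  large neighbours, for the disc itself and its two small neighbours.\<close>

lemma rot_apex:
  "(rot_bb - 1) * apex = - 2"
  "2 * (of_real (1 - sqrt 6 / 3) * (rot_bb * rot_bs) - 1) = (rot_bb - 1) * apex2"
  "2 * (of_real (1 - sqrt 6 / 3) * (rot_bb * rot_bs * zeta) - 1) = (rot_bb - 1) * apex3"
  by (simp_all add: rot_defs apex_def apex2_def apex3_def complex_eq_iff rot_arith)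

text \<open>The thresholds are \<open>Re rot_bb\<close> and \<open>Re rot_bs\<close>, the cosines of
  the smallest angles at which a second large or a small disc fits beside the first large one. Each
  product is the direction reached by a wrong sequence of steps, too close to the start.\<close>

lemma corona_clash:
  "1/6 - sqrt 6 / 3 < Re (rot_bb * rot_bb)"
  "1/6 - sqrt 6 / 3 < Re (rot_bb * rot_bs * rot_bs)"
  "1/6 - sqrt 6 / 3 < Re (rot_bs * rot_bs * rot_bb)"
  "1/6 - sqrt 6 / 3 < Re (rot_bs * rot_bs * rot_bs * rot_bs)"
  "1/2 - sqrt 6 / 6 < Re (rot_bs * rot_bs * rot_bs * zeta)"
  "1/6 - sqrt 6 / 3 < Re (rot_bs * zeta * zeta * rot_bs)"
  "1/6 - sqrt 6 / 3 < Re (rot_bs * zeta * zeta * zeta * rot_bs)"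
  "1/2 - sqrt 6 / 6 < Re (rot_bs * zeta * zeta * zeta * zeta)"
  using sqrt_bounds by (simp_all add: rot_defs rot_arith)

text \<open>A clash between large discs requires the sequence not to have returned to the starting
  disc itself.\<close>

lemma corona_distinct:
  "rot_bb * rot_bb \<noteq> 1" "rot_bb * rot_bs * rot_bs \<noteq> 1" "rot_bs * rot_bs * rot_bb \<noteq> 1"
  "rot_bs * rot_bs * rot_bs * rot_bs \<noteq> 1" "rot_bs * zeta * zeta * rot_bs \<noteq> 1"
  "rot_bs * zeta * zeta * zeta * rot_bs \<noteq> 1"
proof -
  have ne: "z \<noteq> 1" if "Re z < 1" for z :: complex using that by auto
  show "rot_bb * rot_bb \<noteq> 1" "rot_bb * rot_bs * rot_bs \<noteq> 1" "rot_bs * rot_bs * rot_bb \<noteq> 1"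
    "rot_bs * rot_bs * rot_bs * rot_bs \<noteq> 1" "rot_bs * zeta * zeta * rot_bs \<noteq> 1"
    "rot_bs * zeta * zeta * zeta * rot_bs \<noteq> 1"
    by (rule ne; use sqrt_bounds in \<open>simp add: rot_defs rot_arith\<close>)+
qed

lemma norm_diff_sq:
  fixes x y :: complex
  shows "(norm (x - y))\<^sup>2 = (norm x)\<^sup>2 + (norm y)\<^sup>2 - 2 * Re (x * cnj y)"
  unfolding norm_sq by (simp add: power2_eq_square algebra_simps)

section \<open>Neighbours of a small disc in a given compact packing\<close>

locale compact_two_radii =
  fixes P :: "disc set" and r :: real
  assumes r: "r = 5 - 2 * sqrt 6" and compact: "compact_packing_using 1 r P"
begin

lemma pk: "is_packing P"
  using compact by (simp add: compact_packing_using_def compact_packing_def)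

lemma radii: "radius ` P = {1, r}"
  using compact by (simp add: compact_packing_using_def)

lemma r_simps: "r > 0" "1 + r = 6 - 2 * sqrt 6" "r + 1 = 6 - 2 * sqrt 6" "r + r = 10 - 4 * sqrt 6"
  "2 * r = 10 - 4 * sqrt 6" "r \<noteq> 1" "r < 11/100"
  using r sqrt_bounds by auto

lemma disc_radius: "(c, x) \<in> P \<Longrightarrow> x = 1 \<or> x = r"
  using radii by (metis imageI insertE singletonD snd_conv)

lemma sep: "(c, x) \<in> P \<Longrightarrow> (d, y) \<in> P \<Longrightarrow> (c, x) \<noteq> (d, y) \<Longrightarrow> x + y \<le> norm (c - d)"
  using pk by (fastforce simp: is_packing_iff dist_norm)

lemma neighbour_iff:
  assumes "(d, x) \<in> P"
  shows "(e, y) \<in> neighbours P (d, x) \<longleftrightarrow> (e, y) \<in> P \<and> norm (e - d) = x + y"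
proof -
  have "(e, y) \<noteq> (d, x)" if "(e, y) \<in> P" "norm (e - d) = x + y"
  proof
    assume "(e, y) = (d, x)"
    moreover have "x > 0" using pk assms by (fastforce simp: is_packing_iff)
    ultimately show False using that by simp
  qed
  thus ?thesis unfolding neighbours_def tangent_def
    by (auto simp: dist_norm norm_minus_commute)
qed

lemma neighbour_exists:
  assumes "(d, x) \<in> P"
  obtains e y where "(e, y) \<in> P" "norm (e - d) = x + y"
proof -
  have "surrounded P (d, x)" using compact assms by (simp add: compact_packing_using_def compact_packing_def)
  from surrounded_successor(1)[OF pk assms this] obtain E where "E \<in> neighbours P (d, x)" by blast
  thus thesis using that neighbour_iff[OF assms] by (cases E) auto
qed

lemma successor:
  assumes D: "(d, x) \<in> P" and E: "(e, y) \<in> P" "norm (e - d) = x + y"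
  obtains f z where "(f, z) \<in> P" "norm (f - d) = x + z" "norm (f - e) = y + z" "orient d e f > 0"
proof -
  have "surrounded P (d, x)" using compact D by (simp add: compact_packing_using_def compact_packing_def)
  from surrounded_successor(2)[OF pk D this] obtain F where
    F: "F \<in> neighbours P (d, x)" "tangent (e, y) F" "orient d e (centre F) > 0"
    using E neighbour_iff[OF D] by fastforce
  obtain f z where f: "F = (f, z)" by (cases F)
  have "norm (f - e) = y + z" using F(2) f by (simp add: tangent_def dist_norm norm_minus_commute)
  thus thesis using that[of f z] F f neighbour_iff[OF D] by simp
qed

lemma small_step_big:
  assumes s: "(s, r) \<in> P" and x: "norm x = 1" "(s + of_real (1 + r) * x, 1) \<in> P"
  shows "(s + of_real (1 + r) * (x * rot_bb), 1) \<in> P \<or> (s + of_real (2 * r) * (x * rot_bs), r) \<in> P"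
proof -
  let ?e = "s + of_real (1 + r) * x"
  have ne: "norm (?e - s) = r + 1" using x r_simps(1) by (simp add: norm_mult del: of_real_add)
  obtain f z where f: "(f, z) \<in> P" "norm (f - s) = r + z" "norm (f - ?e) = 1 + z" "orient s ?e f > 0"
    using successor[OF s x(2) ne] by blast
  have es: "?e \<noteq> s" using ne r_simps(1) by auto
  from disc_radius[OF f(1)] show ?thesis
  proof
    assume z: "z = 1"
    have "f = s + (?e - s) * rot_bb"
    proof (rule third_vertex[OF es _ _ f(4)])
      show "norm (f - s) = norm rot_bb * norm (?e - s)" using f(2) z ne by (simp add: rot_norms)
      show "norm (f - ?e) = norm (rot_bb - 1) * norm (?e - s)"
        unfolding f(3) z ne rot_norms unfolding r_simps by (simp add: algebra_simps surd_simps)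
    qed (use sqrt_bounds in \<open>simp add: rot_bb_def\<close>)
    thus ?thesis using f(1) z by (simp add: mult.assoc)
  next
    assume z: "z = r"
    have "f = s + (?e - s) * (of_real (1 - sqrt 6 / 3) * rot_bs)"
    proof (rule third_vertex[OF es _ _ f(4)])
      have "norm (of_real (1 - sqrt 6 / 3) * rot_bs) = 1 - sqrt 6 / 3"
        unfolding norm_mult norm_of_real rot_norms using sqrt_bounds by simp
      thus "norm (f - s) = norm (of_real (1 - sqrt 6 / 3) * rot_bs) * norm (?e - s)"
        unfolding f(2) z ne by (simp only: r_simps, simp add: algebra_simps surd_simps)
      show "norm (f - ?e) = norm (of_real (1 - sqrt 6 / 3) * rot_bs - 1) * norm (?e - s)"
        unfolding f(3) z ne rot_norms by simp
    qed (use sqrt_bounds in \<open>simp add: rot_bs_def\<close>)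
    also have "(?e - s) * (of_real (1 - sqrt 6 / 3) * rot_bs) = of_real ((1 + r) * (1 - sqrt 6 / 3)) * (x * rot_bs)"
      by (simp only: of_real_mult add_diff_cancel_left' mult_ac)
    also have "(1 + r) * (1 - sqrt 6 / 3) = 2 * r"
      unfolding r_simps by (simp add: algebra_simps surd_simps)
    finally show ?thesis using f(1) z by simp
  qed
qed

lemma small_step_small:
  assumes s: "(s, r) \<in> P" and x: "norm x = 1" "(s + of_real (2 * r) * x, r) \<in> P"
  shows "(s + of_real (1 + r) * (x * rot_bs), 1) \<in> P \<or> (s + of_real (2 * r) * (x * zeta), r) \<in> P"
proof -
  let ?e = "s + of_real (2 * r) * x"
  have ne: "norm (?e - s) = r + r" using x r_simps(1) by (simp add: norm_mult)
  obtain f z where f: "(f, z) \<in> P" "norm (f - s) = r + z" "norm (f - ?e) = r + z" "orient s ?e f > 0"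
    using successor[OF s x(2) ne] by blast
  have es: "?e \<noteq> s" using ne r_simps(1) by auto
  from disc_radius[OF f(1)] show ?thesis
  proof
    assume z: "z = r"
    have "f = s + (?e - s) * zeta"
      by (rule third_vertex[OF es _ _ f(4)]) (use f z ne in \<open>simp_all add: rot_norms, simp add: zeta_def\<close>)
    thus ?thesis using f(1) z by (simp add: mult.assoc)
  next
    assume z: "z = 1"
    have "f = s + (?e - s) * (of_real (3 + sqrt 6) * rot_bs)"
    proof (rule third_vertex[OF es _ _ f(4)])
      have "norm (of_real (3 + sqrt 6) * rot_bs) = 3 + sqrt 6"
        unfolding norm_mult norm_of_real rot_norms by simp
      thus "norm (f - s) = norm (of_real (3 + sqrt 6) * rot_bs) * norm (?e - s)"
        unfolding f(2) z ne by (simp only: r_simps, simp add: algebra_simps surd_simps)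
      show "norm (f - ?e) = norm (of_real (3 + sqrt 6) * rot_bs - 1) * norm (?e - s)"
        unfolding f(3) z ne rot_norms by (simp only: r_simps, simp add: algebra_simps surd_simps)
      show "Im (of_real (3 + sqrt 6) * rot_bs) > 0"
        by (simp add: rot_bs_def add_pos_pos)
    qed
    also have "(?e - s) * (of_real (3 + sqrt 6) * rot_bs) = of_real ((2 * r) * (3 + sqrt 6)) * (x * rot_bs)"
      by (simp only: of_real_mult add_diff_cancel_left' mult_ac)
    also have "(2 * r) * (3 + sqrt 6) = 1 + r"
      unfolding r_simps by (simp add: algebra_simps surd_simps)
    finally show ?thesis using f(1) z by simp
  qed
qed

lemma big_big_clash:
  assumes x: "norm x = 1" "(s + of_real (1 + r) * x, 1) \<in> P"
    and z: "norm z = 1" "(s + of_real (1 + r) * (x * z), 1) \<in> P" "z \<noteq> 1"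
  shows "\<not> 1/6 - sqrt 6 / 3 < Re z"
proof -
  have x0: "x \<noteq> 0" using x by auto
  have "s + of_real (1 + r) * x \<noteq> s + of_real (1 + r) * (x * z)"
    using x0 z(3) r_simps(1) by (simp del: of_real_add)
  hence "1 + 1 \<le> norm (s + of_real (1 + r) * x - (s + of_real (1 + r) * (x * z)))"
    using sep[OF x(2) z(2)] by blast
  also have "s + of_real (1 + r) * x - (s + of_real (1 + r) * (x * z)) = of_real (1 + r) * x * (1 - z)"
    by (simp add: algebra_simps)
  also have "norm \<dots> = (1 + r) * norm (1 - z)"
    using x r_simps(1) by (simp add: norm_mult del: of_real_add)
  finally have "2\<^sup>2 \<le> ((1 + r) * norm (1 - z))\<^sup>2" by (intro power_mono) auto
  also have "\<dots> = (1 + r)\<^sup>2 * (2 - 2 * Re z)"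
    unfolding power_mult_distrib norm_diff_sq using z by simp
  \<comment> \<open>The factor is the inverse of \<open>(1 + r)\<^sup>2\<close>; the resulting bound
    is \<open>Re z \<le> 1 - 2 / (1 + r)\<^sup>2\<close>.\<close>
  finally have "4 * ((5 + 2 * sqrt 6) / 12) \<le> (1 + r)\<^sup>2 * (2 - 2 * Re z) * ((5 + 2 * sqrt 6) / 12)"
    by (intro mult_right_mono) auto
  also have "\<dots> = ((1 + r)\<^sup>2 * ((5 + 2 * sqrt 6) / 12)) * (2 - 2 * Re z)" by (simp only: mult_ac)
  also have "(1 + r)\<^sup>2 * ((5 + 2 * sqrt 6) / 12) = 1"
    unfolding r_simps by (simp add: power2_eq_square algebra_simps surd_simps)
  finally show ?thesis by simp
qed

text \<open>By the law of cosines disjointness means \<open>Re z \<le> r / (1 + r)\<close>, and the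
  right side equals \<open>1/2 - sqrt 6 / 6\<close>.\<close>

lemma big_small_clash:
  assumes x: "norm x = 1" "(s + of_real (1 + r) * x, 1) \<in> P"
    and z: "norm z = 1" "(s + of_real (2 * r) * (x * z), r) \<in> P"
  shows "\<not> 1/2 - sqrt 6 / 6 < Re z"
proof -
  have "1 + r \<le> norm (s + of_real (1 + r) * x - (s + of_real (2 * r) * (x * z)))"
    using sep[OF x(2) z(2)] r_simps(6) by blast
  also have "s + of_real (1 + r) * x - (s + of_real (2 * r) * (x * z)) = x * (of_real (1 + r) - of_real (2 * r) * z)"
    by (simp add: algebra_simps)
  also have "norm \<dots> = norm (of_real (1 + r) - of_real (2 * r) * z)"
    using x by (simp add: norm_mult)
  finally have "(1 + r)\<^sup>2 \<le> (norm (of_real (1 + r) - of_real (2 * r) * z))\<^sup>2"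
    using r_simps(1) by (intro power_mono) auto
  also have "\<dots> = (1 + r)\<^sup>2 + (2 * r)\<^sup>2 - 2 * ((1 + r) * (2 * r) * Re z)"
    unfolding norm_diff_sq norm_mult z norm_of_real by simp
  finally have "(2 * r) * ((1 + r) * Re z) \<le> (2 * r) * r" by (simp add: power2_eq_square algebra_simps)
  hence "(1 + r) * Re z \<le> r" using r_simps(1) by (simp only: mult_le_cancel_left_pos)
  moreover have "(1 + r) * (1/2 - sqrt 6 / 6) = r"
    unfolding r_simps(2) unfolding r by (simp add: algebra_simps surd_simps)
  ultimately have "(1 + r) * Re z \<le> (1 + r) * (1/2 - sqrt 6 / 6)" by simp
  moreover have "0 < 1 + r" using r_simps(1) by simp
  ultimately show ?thesis by (metis mult_le_cancel_left_pos not_le)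
qed

text \<open>Positions are recorded relative to the large neighbour \<open>x\<close>. The pair of
  large discs consists of \<open>x\<close> and its successor, or, if the successor is small, of
  \<open>x\<close> and its predecessor.\<close>

lemma small_corona:
  assumes s: "(s, r) \<in> P" and x: "norm x = 1" "(s + of_real (1 + r) * x, 1) \<in> P"
  obtains y where "norm y = 1" "(s + of_real (1 + r) * y, 1) \<in> P" "(s + of_real (1 + r) * (y * rot_bb), 1) \<in> P"
    "(s + of_real (2 * r) * (y * (rot_bb * rot_bs)), r) \<in> P"
    "(s + of_real (2 * r) * (y * (rot_bb * rot_bs * zeta)), r) \<in> P"
    "x = y \<or> x = y * rot_bb"
proof -
  define B where "B z \<longleftrightarrow> norm z = 1 \<and> (s + of_real (1 + r) * (x * z), 1) \<in> P" for z
  define S where "S z \<longleftrightarrow> norm z = 1 \<and> (s + of_real (2 * r) * (x * z), r) \<in> P" for z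
  have B1: "B 1" using x by (simp add: B_def)
  have BB: "B (z * rot_bb) \<or> S (z * rot_bs)" if "B z" for z
    using small_step_big[OF s, of "x * z"] that x rot_norms unfolding B_def S_def by (simp add: norm_mult mult.assoc)
  have SS: "B (z * rot_bs) \<or> S (z * zeta)" if "S z" for z
    using small_step_small[OF s, of "x * z"] that x rot_norms unfolding B_def S_def by (simp add: norm_mult mult.assoc)
  have nB: "\<not> B z" if "1/6 - sqrt 6 / 3 < Re z" "z \<noteq> 1" for z
    using big_big_clash[OF x, of z] that unfolding B_def by blast
  have nS: "\<not> S z" if "1/2 - sqrt 6 / 6 < Re z" for z
    using big_small_clash[OF x, of z] that unfolding S_def by blast
  note clash = nB[OF corona_clash(1) corona_distinct(1)] nB[OF corona_clash(2) corona_distinct(2)]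
    nB[OF corona_clash(3) corona_distinct(3)] nB[OF corona_clash(4) corona_distinct(4)]
    nS[OF corona_clash(5)] nB[OF corona_clash(6) corona_distinct(5)]
    nB[OF corona_clash(7) corona_distinct(6)] nS[OF corona_clash(8)]
  have "B rot_bb \<or> S rot_bs" using BB[OF B1] by simp
  hence "(B rot_bb \<and> S (rot_bb * rot_bs) \<and> S (rot_bb * rot_bs * zeta)) \<or>
    (S rot_bs \<and> S (rot_bs * zeta) \<and> B (rot_bs * zeta * rot_bs))"
  proof
    assume "B rot_bb" thus ?thesis using BB SS clash by blast
  next
    assume S1: "S rot_bs"
    \<comment> \<open>After large, small, large, every continuation runs into the starting
      disc.\<close>
    have "\<not> B (rot_bs * rot_bs)" using BB SS clash by blast
    hence S2: "S (rot_bs * zeta)" using SS[OF S1] by blast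
    \<comment> \<open>Likewise a third consecutive small disc leaves no admissible
      continuation.\<close>
    have "\<not> S (rot_bs * zeta * zeta)" using SS clash by blast
    thus ?thesis using S1 S2 SS by blast
  qed
  thus thesis
  proof
    assume "B rot_bb \<and> S (rot_bb * rot_bs) \<and> S (rot_bb * rot_bs * zeta)"
    thus thesis using that[of x] x unfolding B_def S_def by (simp add: mult.assoc)
  next
    assume *: "S rot_bs \<and> S (rot_bs * zeta) \<and> B (rot_bs * zeta * rot_bs)"
    \<comment> \<open>The last disc found precedes \<open>x\<close>: by \<open>rot_product\<close>
      one more turn by \<open>rot_bb\<close> returns to \<open>x\<close>.\<close>
    define y where "y = x * (rot_bs * zeta * rot_bs)"
    have "y * rot_bb = x * (rot_bs * zeta * rot_bs * rot_bb)" by (simp only: y_def mult.assoc)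
    hence e: "y * rot_bb = x" by (simp add: rot_product)
    hence e': "y * (rot_bb * rot_bs) = x * rot_bs" "y * (rot_bb * rot_bs * zeta) = x * (rot_bs * zeta)"
      by (simp_all only: mult.assoc[symmetric])
    have "norm y = 1" using * x by (simp add: y_def B_def norm_mult)
    thus thesis
    proof (rule that)
      show "(s + of_real (1 + r) * y, 1) \<in> P" using * unfolding B_def y_def by blast
      show "(s + of_real (1 + r) * (y * rot_bb), 1) \<in> P" unfolding e by (rule x(2))
      show "(s + of_real (2 * r) * (y * (rot_bb * rot_bs)), r) \<in> P"
        "(s + of_real (2 * r) * (y * (rot_bb * rot_bs * zeta)), r) \<in> P"
        using * unfolding e' S_def by blast+
    qed (use e in simp)
  qed
qed

definition bigs :: "complex set" where "bigs = {c. (c, 1) \<in> P}"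

lemma bigs_sep: "c \<in> bigs \<Longrightarrow> d \<in> bigs \<Longrightarrow> norm (c - d) < 2 \<Longrightarrow> c = d"
  using sep[of c 1 d 1] by (force simp: bigs_def)

text \<open>Rewrites the corona in lattice coordinates: \<open>E\<close> is the first of the two
  large neighbours and \<open>2 * u\<close> the vector to the second, so that \<open>s\<close> lies
  to the left.\<close>

lemma small_corona_frame:
  assumes s: "(s, r) \<in> P" and D: "D \<in> bigs" "norm (D - s) = 1 + r"
  obtains E u where "norm u = 1" "E \<in> bigs" "E + 2 * u \<in> bigs" "s = small_at E u"
    "(E + u * apex2, r) \<in> P" "(E + u * apex3, r) \<in> P" "D = E \<or> D = E + 2 * u"
proof -
  define x where "x = (D - s) / of_real (1 + r)"
  have r1: "of_real (1 + r) \<noteq> (0 :: complex)" using r_simps(1) by (simp del: of_real_add)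
  have nx: "norm x = 1" using D r_simps(1) by (simp add: x_def norm_divide del: of_real_add)
  have Dx: "D = s + of_real (1 + r) * x" using r1 by (simp add: x_def del: of_real_add)
  obtain y where y: "norm y = 1" "(s + of_real (1 + r) * y, 1) \<in> P" "(s + of_real (1 + r) * (y * rot_bb), 1) \<in> P"
    "(s + of_real (2 * r) * (y * (rot_bb * rot_bs)), r) \<in> P"
    "(s + of_real (2 * r) * (y * (rot_bb * rot_bs * zeta)), r) \<in> P"
    "x = y \<or> x = y * rot_bb"
    using small_corona[OF s nx] D(1) Dx unfolding bigs_def by blast
  define E where "E = s + of_real (1 + r) * y"
  define u where "u = of_real (1 + r) * y * (rot_bb - 1) / 2"
  have u2: "2 * u = of_real (1 + r) * y * (rot_bb - 1)" by (simp only: u_def double_half)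
  have "2 * norm u = norm (2 * u)" by (simp add: norm_mult)
  also have "\<dots> = (1 + r) * (1 + sqrt 6 / 3)"
    unfolding u2 norm_mult y rot_norms using r_simps(1) by (simp del: of_real_add)
  also have "\<dots> = 2" unfolding r_simps by (simp add: algebra_simps surd_simps)
  finally have nu: "norm u = 1" by simp
  have E2: "E + 2 * u = s + of_real (1 + r) * (y * rot_bb)"
    unfolding u2 E_def by (simp add: algebra_simps)
  have k: "of_real (2 * r) = of_real (1 + r) * (of_real (1 - sqrt 6 / 3) :: complex)"
  proof -
    have "2 * r = (1 + r) * (1 - sqrt 6 / 3)" unfolding r_simps by (simp add: algebra_simps surd_simps)
    thus ?thesis by (simp only: of_real_mult)
  qed
  have pt: "E + u * a = s + of_real (1 + r) * y * w" if "2 * (w - 1) = (rot_bb - 1) * a" for a w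
  proof -
    have "2 * (u * a) = of_real (1 + r) * y * ((rot_bb - 1) * a)" by (simp only: mult.assoc[symmetric] u2)
    also have "\<dots> = 2 * (of_real (1 + r) * y * (w - 1))" unfolding that[symmetric] by (simp only: mult_ac)
    finally have "u * a = of_real (1 + r) * y * (w - 1)" by (simp only: mult_cancel_left) simp
    thus ?thesis by (simp add: E_def algebra_simps)
  qed
  have "E + u * apex = s + of_real (1 + r) * y * 0" by (rule pt) (simp add: rot_apex)
  hence "s = small_at E u" by (simp add: small_at_def)
  moreover have "(E + u * apex2, r) \<in> P" using y(4) pt[OF rot_apex(2)] unfolding k by (simp only: mult_ac)
  moreover have "(E + u * apex3, r) \<in> P" using y(5) pt[OF rot_apex(3)] unfolding k by (simp only: mult_ac)
  moreover have "E \<in> bigs" "E + 2 * u \<in> bigs" using y(2,3) unfolding E2 by (simp_all add: bigs_def E_def)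
  moreover have "D = E \<or> D = E + 2 * u" using y(6) E2 Dx E_def by metis
  ultimately show thesis using that[OF nu] by blast
qed

end

subsection \<open>Compact packings are filled lattices\<close>

text \<open>Stewart's theorem.\<close>

lemma segment_dist_sq:
  fixes a b c :: complex
  shows "(norm ((1 - t) *\<^sub>R a + t *\<^sub>R b - c))\<^sup>2
    = (1 - t) * (norm (a - c))\<^sup>2 + t * (norm (b - c))\<^sup>2 - t * (1 - t) * (norm (a - b))\<^sup>2"
  unfolding norm_sq by (simp add: power2_eq_square algebra_simps)

context compact_two_radii
begin

text \<open>All six discs of the filled hole are demanded, which makes the condition invariant under
  passing to the next side.\<close>

definition filled :: "complex \<Rightarrow> complex \<Rightarrow> bool" where
  "filled E u \<longleftrightarrow> norm u = 1 \<and> E \<in> bigs \<and> E + 2 * u \<in> bigs \<and> E + 2 * (u * zeta) \<in> bigs \<and>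
    (small_at E u, r) \<in> P \<and> (E + u * apex2, r) \<in> P \<and> (E + u * apex3, r) \<in> P"

lemma close_directions:
  assumes "E + 2 * u \<in> bigs" "E + 2 * v \<in> bigs" "norm (u - v) < 1"
  shows "u = v"
proof -
  have "E + 2 * u - (E + 2 * v) = 2 * (u - v)" by simp
  hence "norm (E + 2 * u - (E + 2 * v)) = 2 * norm (u - v)" by (simp only: norm_mult) simp
  hence "E + 2 * u = E + 2 * v" using bigs_sep[OF assms(1,2)] assms(3) by simp
  thus ?thesis by simp
qed

text \<open>The two inequalities say that the directions of \<open>apex3\<close> and of
  \<open>cnj apex\<close> are less than 60 degrees from that of \<open>apex\<close>, so unit discs
  cannot sit in two directions differing by that much.\<close>

lemma apex_facts:
  "apex \<noteq> 0" "apex \<noteq> 2" "2 - apex = cnj apex" "apex3 = zeta * cnj apex" "apex \<noteq> apex3" "cnj apex \<noteq> apex" "cnj apex \<noteq> 0"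
  "norm (apex3 - apex) < norm apex" "norm (cnj apex - apex) < norm apex"
proof -
  show "apex \<noteq> 0" "apex \<noteq> 2" "2 - apex = cnj apex" "cnj apex \<noteq> 0" by (auto simp: apex_def complex_eq_iff)
  show "apex3 = zeta * cnj apex"
    by (simp add: apex_def apex3_def zeta_def complex_eq_iff algebra_simps surd_simps)
  show "apex \<noteq> apex3" using norm_apexes(7) r_simps by auto
  show "norm (apex3 - apex) < norm apex"
    using norm_apexes(7) sqrt_bounds by (simp add: norm_minus_commute[of apex3] norm_apex)
  have "norm (cnj apex - apex) = 2 * (4 * sqrt 2 - 3 * sqrt 3)"
    by (rule norm_eq_surd) (use sqrt_bounds in \<open>auto simp: apex_def power2_eq_square algebra_simps surd_simps\<close>)
  thus "cnj apex \<noteq> apex" "norm (cnj apex - apex) < norm apex" using sqrt_bounds by (auto simp: norm_apex)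
qed

text \<open>The corona of \<open>s\<close> does not contain the third corner of the hole. It comes
  from the corona of the small disc at \<open>apex3\<close>, which touches \<open>E\<close>: if
  \<open>E\<close> started the side of that disc, two large neighbours of \<open>E\<close> would be
  less than 60 degrees apart; so \<open>E\<close> ends it, and its start is the missing
  corner.\<close>

lemma small_filled:
  assumes s: "(s, r) \<in> P" and D: "D \<in> bigs" "norm (D - s) = 1 + r"
  obtains E u where "filled E u" "s = small_at E u" "D = E \<or> D = E + 2 * u"
proof -
  obtain E u where Eu: "norm u = 1" "E \<in> bigs" "E + 2 * u \<in> bigs" "s = small_at E u"
    "(E + u * apex2, r) \<in> P" "(E + u * apex3, r) \<in> P" "D = E \<or> D = E + 2 * u"
    using small_corona_frame[OF s D] by blast
  have "norm (E - (E + u * apex3)) = 1 + r"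
    using Eu(1) norm_apexes(1) r_simps(2) by (simp add: norm_mult)
  from small_corona_frame[OF Eu(6,2) this] obtain F v where
    Fv: "norm v = 1" "F \<in> bigs" "F + 2 * v \<in> bigs" "E + u * apex3 = small_at F v" "E = F \<or> E = F + 2 * v"
    by metis
  have "E + 2 * (u * zeta) \<in> bigs"
    using Fv(5)
  proof
    assume EF: "E = F"
    hence eq: "u * apex3 = v * apex" using Fv(4) by (simp add: small_at_def)
    have "(u - v) * apex = u * apex - u * apex3" unfolding eq by (simp add: algebra_simps)
    hence "norm (u - v) * norm apex = norm (apex - apex3)"
      using Eu(1) by (metis norm_frame norm_mult right_diff_distrib)
    also have "\<dots> < 1 * norm apex" using apex_facts(8) by (simp add: norm_minus_commute)
    finally have "norm (u - v) < 1" by (rule mult_right_less_imp_less) simp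
    hence "u = v" using close_directions[of E u v] Eu(3) Fv(3) EF by blast
    moreover have "u \<noteq> 0" using Eu(1) by auto
    ultimately show ?thesis using eq apex_facts(5) by simp
  next
    assume EF: "E = F + 2 * v"
    hence "u * apex3 = v * apex - 2 * v" using Fv(4) by (simp add: small_at_def algebra_simps)
    also have "\<dots> = - v * cnj apex" unfolding apex_facts(3)[symmetric] by (simp add: algebra_simps)
    finally have "(u * zeta) * cnj apex = - v * cnj apex" unfolding apex_facts(4) by (simp only: mult.assoc)
    hence "u * zeta = - v" using apex_facts(7) by (metis mult_right_cancel)
    thus ?thesis using Fv(2) EF by simp
  qed
  hence "filled E u" using Eu s by (simp add: filled_def)
  thus thesis using that Eu by blast
qed

lemma hexagonal_bigs: "hexagonal bigs"
  unfolding hexagonal_def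
proof (intro conjI ballI allI impI)
  fix D assume D: "D \<in> bigs"
  hence DP: "(D, 1) \<in> P" by (simp add: bigs_def)
  obtain e y where e: "(e, y) \<in> P" "norm (e - D) = 1 + y" using neighbour_exists[OF DP] by blast
  from disc_radius[OF e(1)] show "\<exists>u. norm u = 1 \<and> D + 2 * u \<in> bigs"
  proof
    assume y: "y = 1"
    have "norm ((e - D) / 2) = 1" by (simp only: norm_divide e y) simp
    moreover have "D + 2 * ((e - D) / 2) = e" by (simp only: double_half) simp
    ultimately show ?thesis using e y by (metis bigs_def mem_Collect_eq)
  next
    assume y: "y = r"
    obtain E u where E: "filled E u" "D = E \<or> D = E + 2 * u"
      using small_filled[of e D] e y D by (metis norm_minus_commute)
    hence "norm u = 1" "norm (- u) = 1" "E \<in> bigs" "E + 2 * u \<in> bigs" "E + 2 * u + 2 * (- u) = E"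
      by (auto simp: filled_def)
    thus ?thesis using E(2) by metis
  qed
next
  fix D u assume D: "D \<in> bigs" and u: "norm u = 1" "D + 2 * u \<in> bigs"
  hence DP: "(D, 1) \<in> P" and E: "(D + 2 * u, 1) \<in> P" by (auto simp: bigs_def)
  have nE: "norm (D + 2 * u - D) = 1 + 1" using u by (simp add: norm_mult)
  obtain f z where f: "(f, z) \<in> P" "norm (f - D) = 1 + z" "norm (f - (D + 2 * u)) = 1 + z"
    "orient D (D + 2 * u) f > 0" using successor[OF DP E nE] by blast
  have ne: "D + 2 * u \<noteq> D" using nE by auto
  from disc_radius[OF f(1)] show "D + 2 * (u * zeta) \<in> bigs"
  proof
    assume z: "z = 1"
    have "f = D + (D + 2 * u - D) * zeta"
      by (rule third_vertex[OF ne _ _ f(4)])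
        (unfold f(2,3) z nE rot_norms norm_zeta, simp_all, simp add: zeta_def)
    thus ?thesis using f(1) z by (simp add: bigs_def mult.assoc)
  next
    assume z: "z = r"
    have "f = D + (D + 2 * u - D) * (apex / 2)"
    proof (rule third_vertex[OF ne _ _ f(4)])
      show "norm (f - D) = norm (apex / 2) * norm (D + 2 * u - D)"
        unfolding f z nE r_simps norm_divide norm_apex by simp
      have "apex / 2 - 1 = (apex - 2) / 2" by (simp add: diff_divide_distrib)
      thus "norm (f - (D + 2 * u)) = norm (apex / 2 - 1) * norm (D + 2 * u - D)"
        unfolding f z nE r_simps by (simp only: norm_divide norm_apex_other) simp
      show "Im (apex / 2) > 0" using sqrt_bounds by (simp add: apex_def)
    qed
    hence fs: "f = small_at D u" by (simp add: small_at_def)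
    obtain E v where Ev: "filled E v" "f = small_at E v" "D = E \<or> D = E + 2 * v"
      using small_filled[of f D] f(1,2) z D by (metis norm_minus_commute)
    from Ev(3) show ?thesis
    proof
      assume "D = E"
      hence "u = v" using fs Ev(2) apex_facts(1) by (simp add: small_at_def)
      thus ?thesis using Ev(1) \<open>D = E\<close> by (simp add: filled_def)
    next
      \<comment> \<open>Impossible: the large neighbours of \<open>D\<close> in the directions
        \<open>u\<close> and \<open>- v\<close> would be less than 60 degrees apart, hence equal,
        making \<open>apex\<close> real.\<close>
      assume DE: "D = E + 2 * v"
      hence "u * apex = v * apex - 2 * v" using fs Ev(2) by (simp add: small_at_def algebra_simps)
      also have "\<dots> = - v * cnj apex" unfolding apex_facts(3)[symmetric] by (simp add: algebra_simps)
      finally have eq: "u * apex = - v * cnj apex" .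
      have "(u - - v) * cnj apex = u * cnj apex - u * apex" unfolding eq by (simp add: algebra_simps)
      hence "norm (u - - v) * norm (cnj apex) = norm (cnj apex - apex)"
        using u(1) by (metis norm_frame norm_mult right_diff_distrib)
      also have "\<dots> < 1 * norm (cnj apex)" using apex_facts(9) by simp
      finally have "norm (u - - v) < 1" by (rule mult_right_less_imp_less) simp
      moreover have "D + 2 * (- v) \<in> bigs" using Ev(1) DE by (simp add: filled_def)
      ultimately have "u = - v" using close_directions[of D u "- v"] u(2) by blast
      moreover have "u \<noteq> 0" using u(1) by auto
      ultimately show ?thesis using eq apex_facts(6) by simp
    qed
  qed
next
  fix D E assume "D \<in> bigs" "E \<in> bigs" "D \<noteq> E"
  thus "2 \<le> dist D E" using bigs_sep[of D E] unfolding dist_norm by (meson not_le)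
qed

lemma bigs_nonempty: "bigs \<noteq> {}"
proof -
  have "1 \<in> radius ` P" using radii by simp
  then obtain D where "D \<in> P" "radius D = 1" by auto
  thus ?thesis by (cases D) (auto simp: bigs_def)
qed

text \<open>Otherwise the disc is the centre of a hexagon of small discs, too large for a hole: some
  unit disc has its centre within 6/5, hence overlaps a corner of the hexagon.\<close>

lemma small_has_big_neighbour:
  assumes s: "(s, r) \<in> P"
  obtains D where "D \<in> bigs" "norm (D - s) = 1 + r"
proof (rule ccontr)
  assume "\<not> thesis"
  hence no: "(f, z) \<in> P \<Longrightarrow> norm (f - s) = r + z \<Longrightarrow> z = r" for f z
    using disc_radius that by (fastforce simp: bigs_def)
  have next_small: "(s + (e - s) * zeta, r) \<in> P \<and> norm ((e - s) * zeta) = r + r"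
    if e: "(e, r) \<in> P \<and> norm (e - s) = r + r" for e
  proof -
    obtain f z where f: "(f, z) \<in> P" "norm (f - s) = r + z" "norm (f - e) = r + z" "orient s e f > 0"
      using successor[OF s] e by blast
    have z: "z = r" by (rule no[OF f(1,2)])
    have "e \<noteq> s" using e r_simps(1) by auto
    hence "f = s + (e - s) * zeta"
      by (rule third_vertex[OF _ _ _ f(4)])
        (use f(2,3) z e in \<open>simp_all add: rot_norms\<close>, simp add: zeta_def)
    thus ?thesis using f z e by (simp add: norm_mult)
  qed
  obtain e y where ey: "(e, y) \<in> P" "norm (e - s) = r + y" using neighbour_exists[OF s] by blast
  define a where "a = e - s"
  have a: "(s + a, r) \<in> P \<and> norm a = r + r" using ey no[OF ey] by (simp add: a_def)
  have step: "(s + b * zeta, r) \<in> P \<and> norm (b * zeta) = r + r" if "(s + b, r) \<in> P \<and> norm b = r + r" for b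
    using next_small[of "s + b"] that by simp
  have hexagon: "\<forall>w\<in>hexad. (s + a * w, r) \<in> P"
  proof -
    note 1 = step[of a] and 2 = step[of "a * zeta"] and 3 = step[of "a * (zeta - 1)"] and 4 = step[of "a * -1"]
      and 5 = step[of "a * - zeta"]
    have "a * zeta * zeta = a * (zeta - 1)" "a * (zeta - 1) * zeta = a * - 1" "a * - 1 * zeta = a * - zeta"
      "a * - zeta * zeta = a * (1 - zeta)"
      by (simp_all add: algebra_simps zeta_sq)
    thus ?thesis using 1 2 3 4 5 a by (metis insertE empty_iff mult.right_neutral)
  qed
  obtain D where D: "D \<in> bigs" "norm (s - D) < 6/5"
    using hexagonal_cover[OF hexagonal_bigs bigs_nonempty] by blast
  define d where "d = norm (D - s)"
  have d2: "d < 6/5" using D by (simp add: d_def norm_minus_commute)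
  have "(D, 1) \<noteq> (s, r)" using r_simps by auto
  hence d1: "1 + r \<le> d" using sep[of D 1 s r] D(1) s by (simp add: bigs_def d_def)
  \<comment> \<open>The corner of the hexagon within 30 degrees of the direction of
    \<open>D\<close>; the law of cosines at \<open>s\<close> then bounds its distance from
    \<open>D\<close>.\<close>
  obtain w where w: "w \<in> hexad" "sqrt 3 / 2 * norm ((D - s) * cnj a) \<le> Re ((D - s) * cnj a * cnj w)"
    using sextant by blast
  have nw: "norm w = 1" using w(1) rot_norms by (auto simp: norm_minus_commute)
  have "(D, 1) \<noteq> (s + a * w, r)" using r_simps by auto
  hence "1 + r \<le> norm (D - (s + a * w))"
    using sep[of D 1 "s + a * w" r] D(1) hexagon w(1) unfolding bigs_def by blast
  also have "D - (s + a * w) = (D - s) - a * w" by simp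
  finally have "(1 + r)\<^sup>2 \<le> (norm ((D - s) - a * w))\<^sup>2" using r_simps(1) by (intro power_mono) auto
  also have "\<dots> = d\<^sup>2 + (r + r)\<^sup>2 - 2 * Re ((D - s) * cnj (a * w))"
    unfolding norm_diff_sq[of "D - s"] using a nw by (simp add: d_def norm_mult)
  finally have "(1 + r)\<^sup>2 \<le> d\<^sup>2 + (r + r)\<^sup>2 - 2 * Re ((D - s) * cnj (a * w))" .
  moreover have "sqrt 3 / 2 * (d * (r + r)) \<le> Re ((D - s) * cnj (a * w))"
    using w(2) a by (simp add: norm_mult d_def mult.assoc)
  moreover have "d * (d - sqrt 3 * (r + r)) = d\<^sup>2 - 2 * (sqrt 3 / 2 * (d * (r + r)))"
    by (simp add: power2_eq_square algebra_simps)
  ultimately have le: "(1 + r)\<^sup>2 \<le> d * (d - sqrt 3 * (r + r)) + (r + r)\<^sup>2" by linarith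
  have "sqrt 3 * (r + r) = 10 * sqrt 3 - 12 * sqrt 2"
    unfolding r_simps by (simp add: algebra_simps surd_simps)
  hence k: "17/50 < sqrt 3 * (r + r)" "sqrt 3 * (r + r) < 1" using sqrt_bounds by linarith+
  \<comment> \<open>Here 43/50 is 6/5 - 17/50. The product stays below
    \<open>(1 + r)\<^sup>2 - (r + r)\<^sup>2\<close>, which is about 1.17.\<close>
  have "d * (d - sqrt 3 * (r + r)) \<le> (6/5) * (43/50)"
    by (intro mult_mono) (use d1 d2 k r_simps(1) in linarith)+
  hence "d * (d - sqrt 3 * (r + r)) \<le> 129/125" by simp
  moreover have "(1 + r)\<^sup>2 = 60 - 24 * sqrt 6" "(r + r)\<^sup>2 = 196 - 80 * sqrt 6"
    unfolding r_simps by (simp_all add: power2_eq_square algebra_simps surd_simps)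
  ultimately show False using le sqrt_bounds(5,6) by linarith
qed

lemma smalls_filled: "(s, r) \<in> P \<longleftrightarrow> (\<exists>E u. filled E u \<and> s = small_at E u)"
  using small_has_big_neighbour[of s] small_filled[of s] by (metis filled_def)

text \<open>Makes the distance estimates for filled lattices available for the given
  packing.\<close>

sublocale lattice: filled_lattice bigs filled r P
proof
  show "hexagonal bigs" by (rule hexagonal_bigs)
  show "r = 5 - 2 * sqrt 6" by (rule r)
  show "filled D u \<Longrightarrow> D \<in> bigs \<and> D + 2 * u \<in> bigs \<and> norm u = 1" for D u by (simp add: filled_def)
  show "filled (D + 2 * u) (u * (zeta - 1))" if f: "filled D u" for D u
  proof -
    have e: "D + 2 * u + 2 * (u * (zeta - 1)) = D + 2 * (u * zeta)" by (simp add: algebra_simps)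
    have e1: "D + 2 * u + 2 * (u * (zeta - 1) * zeta) = D" by (simp add: algebra_simps zeta_sq)
    have "2 + (zeta - 1) * apex2 = apex3" "2 + (zeta - 1) * apex3 = apex"
      by (simp_all add: zeta_def apex_def apex2_def apex3_def complex_eq_iff algebra_simps surd_simps)
    hence e2: "D + 2 * u + u * (zeta - 1) * apex2 = D + u * apex3" "D + 2 * u + u * (zeta - 1) * apex3 = D + u * apex"
      by (metis (no_types, opaque_lifting) add.assoc distrib_left mult.assoc mult.commute)+
    show ?thesis using f unfolding filled_def small_at_turn e e1 e2
      by (simp add: norm_mult rot_norms small_at_def)
  qed
  show "P = unit_discs bigs \<union> {(small_at D u, r) |D u. filled D u}"
  proof (intro equalityI subsetI)
    fix D assume "D \<in> P"
    moreover obtain c x where "D = (c, x)" by (cases D)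
    ultimately show "D \<in> unit_discs bigs \<union> {(small_at D u, r) |D u. filled D u}"
      using disc_radius[of c x] smalls_filled by (auto simp: bigs_def)
  qed (auto simp: bigs_def filled_def)
qed

section \<open>Holes and the small discs in them\<close>

definition gaps :: "complex set" where "gaps = - (\<Union>D\<in>unit_discs bigs. body D)"

lemma gaps_iff: "x \<in> gaps \<longleftrightarrow> (\<forall>X\<in>bigs. 1 < norm (x - X))"
  by (auto simp: gaps_def body_def dist_norm norm_minus_commute not_le)

lemma holes_eq: "holes (unit_discs bigs) = components gaps"
  by (simp add: holes_def gaps_def)

lemma big_small_dist: "(c, r) \<in> P \<Longrightarrow> X \<in> bigs \<Longrightarrow> 1 + r \<le> norm (c - X)"
  using sep[of c r X 1] r_simps(6) by (auto simp: bigs_def)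

lemma small_in_gaps: "(c, r) \<in> P \<Longrightarrow> ball c r \<subseteq> gaps"
proof
  fix x assume c: "(c, r) \<in> P" and x: "x \<in> ball c r"
  have "1 < norm (x - X)" if "X \<in> bigs" for X
    using big_small_dist[OF c that] norm_triangle_ineq[of "c - x" "x - X"] x by (simp add: dist_norm)
  thus "x \<in> gaps" by (simp add: gaps_iff)
qed

lemma small_in_hole: "(c, r) \<in> P \<Longrightarrow> H \<in> holes (unit_discs bigs) \<Longrightarrow> c \<in> H \<Longrightarrow> ball c r \<subseteq> H"
  unfolding holes_eq using r_simps(1)
  by (intro components_maximal[of H gaps]) (auto intro: small_in_gaps[THEN subsetD])

text \<open>The segment of centres avoids the unit discs: by Stewart's theorem its points have
  squared distance at least \<open>(1 + r)\<^sup>2 - r\<^sup>2 = 1 + 2 * r\<close> from every large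
  centre.\<close>

lemma tangent_smalls_same_hole:
  assumes c: "(c, r) \<in> P" and d: "(d, r) \<in> P" and cd: "norm (c - d) = 2 * r"
    and H: "H \<in> holes (unit_discs bigs)" and cH: "c \<in> H"
  shows "d \<in> H"
proof -
  have "closed_segment c d \<subseteq> gaps"
  proof
    fix x assume "x \<in> closed_segment c d"
    then obtain t where t: "0 \<le> t" "t \<le> 1" "x = (1 - t) *\<^sub>R c + t *\<^sub>R d" by (auto simp: closed_segment_def)
    have "1 < norm (x - X)" if X: "X \<in> bigs" for X
    proof -
      have "0 \<le> (1 - 2 * t)\<^sup>2" by simp
      hence "t * (1 - t) \<le> 1/4" by (simp add: power2_eq_square algebra_simps)
      hence "t * (1 - t) * (2 * r)\<^sup>2 \<le> 1/4 * (2 * r)\<^sup>2" by (intro mult_right_mono) auto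
      moreover have "(1 + r)\<^sup>2 \<le> (norm (c - X))\<^sup>2" "(1 + r)\<^sup>2 \<le> (norm (d - X))\<^sup>2"
        using big_small_dist[OF c X] big_small_dist[OF d X] r_simps(1) by (auto intro: power_mono)
      hence "(1 - t) * (1 + r)\<^sup>2 + t * (1 + r)\<^sup>2 \<le> (1 - t) * (norm (c - X))\<^sup>2 + t * (norm (d - X))\<^sup>2"
        using t by (intro add_mono mult_left_mono) auto
      ultimately have "(1 - t) * (1 + r)\<^sup>2 + t * (1 + r)\<^sup>2 - 1/4 * (2 * r)\<^sup>2 \<le> (norm (x - X))\<^sup>2"
        unfolding t(3) segment_dist_sq cd by linarith
      moreover have "(1 - t) * (1 + r)\<^sup>2 + t * (1 + r)\<^sup>2 - 1/4 * (2 * r)\<^sup>2 = 1 + 2 * r"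
        by (simp add: power2_eq_square algebra_simps)
      ultimately have "1\<^sup>2 < (norm (x - X))\<^sup>2" using r_simps(1) by simp
      thus ?thesis by (rule power_less_imp_less_base) simp
    qed
    thus "x \<in> gaps" by (simp add: gaps_iff)
  qed
  hence "closed_segment c d \<subseteq> H"
    using H cH unfolding holes_eq by (intro components_maximal[of H gaps]) auto
  thus ?thesis by auto
qed

definition occupants :: "complex set \<Rightarrow> disc set" where
  "occupants H = {(c, r) |c. (c, r) \<in> P \<and> c \<in> H}"

text \<open>The hole lies in the incircle, which leaves room for these three positions only;
  conversely the other two discs are tangent to the first and so share its hole.\<close>

lemma occupants_eq:
  assumes H: "H \<in> holes (unit_discs bigs)" and f: "filled D u" and cH: "small_at D u \<in> H"
  shows "occupants H = {(D + u * apex, r), (D + u * apex2, r), (D + u * apex3, r)}"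
proof (intro equalityI subsetI)
  have u: "norm u = 1" and D: "D \<in> bigs" "D + 2 * u \<in> bigs" "D + 2 * (u * zeta) \<in> bigs"
    using f by (auto simp: filled_def)
  have P: "(D + u * apex, r) \<in> P" "(D + u * apex2, r) \<in> P" "(D + u * apex3, r) \<in> P"
    using f by (auto simp: filled_def small_at_def)
  {
    fix s assume "s \<in> occupants H"
    then obtain c where c: "s = (c, r)" "(c, r) \<in> P" "c \<in> H" by (auto simp: occupants_def)
    obtain E v where E: "filled E v" "c = small_at E v" using smalls_filled c(2) by blast
    have "H \<subseteq> ball (hole_centre D u) (sqrt 3 / 3)"
      by (rule hole_in_ball[OF D u H cH small_near_hole_centre(1)[OF u]])
    hence "norm (small_at E v - hole_centre D u) < sqrt 3 / 3"
      using c(3) E(2) by (auto simp: dist_norm norm_minus_commute)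
    hence "(E = D \<and> v = u) \<or> (E = D + 2 * u \<and> v = u * (zeta - 1)) \<or> (E = D + 2 * (u * zeta) \<and> v = - (u * zeta))"
      by (intro small_at_determined[OF hexagonal_bigs D(1,2) u]) (use E in \<open>auto simp: filled_def\<close>)
    thus "s \<in> {(D + u * apex, r), (D + u * apex2, r), (D + u * apex3, r)}"
      using c(1) E(2) by (auto simp: small_at_turn) (simp add: small_at_def)
  next
    have "norm (D + u * apex - (D + u * apex2)) = 2 * r" "norm (D + u * apex - (D + u * apex3)) = 2 * r"
      using dist_frame[OF u, of D apex] norm_apexes r_simps by (simp_all only: dist_norm)
    hence "D + u * apex2 \<in> H" "D + u * apex3 \<in> H"
      using tangent_smalls_same_hole[OF P(1) _ _ H] P cH by (auto simp: small_at_def)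
    thus "s \<in> occupants H" if "s \<in> {(D + u * apex, r), (D + u * apex2, r), (D + u * apex3, r)}" for s
      using that P cH by (auto simp: occupants_def small_at_def)
  }
qed

lemma occupants_cluster:
  assumes H: "H \<in> holes (unit_discs bigs)" and f: "filled D u" and cH: "small_at D u \<in> H"
  shows "is_cluster (unit_discs bigs) r H (occupants H)"
  unfolding is_cluster_def
proof (intro conjI ballI impI)
  note eq = occupants_eq[OF assms]
  have u: "norm u = 1" using f by (auto simp: filled_def)
  have u0: "u \<noteq> 0" using u by auto
  have ne: "apex \<noteq> apex2" "apex \<noteq> apex3" "apex2 \<noteq> apex3" using norm_apexes(5-7) r_simps by auto
  show "card (occupants H) = 3" unfolding eq using ne u0 by simp
  fix s assume s: "s \<in> occupants H"
  then obtain c where c: "s = (c, r)" "(c, r) \<in> P" "c \<in> H" by (auto simp: occupants_def)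
  show "radius s = r" by (simp add: c)
  have b: "ball c r \<subseteq> H" by (rule small_in_hole[OF c(2) H c(3)])
  thus "interior (body s) \<subseteq> H" by (simp add: c body_def)
  obtain E v where E: "filled E v" "c = small_at E v" using smalls_filled c(2) by blast
  have v: "norm v = 1" and EB: "E \<in> bigs" "E + 2 * v \<in> bigs" using E by (auto simp: filled_def)
  have touch: "(X, 1) \<in> bounding_discs (unit_discs bigs) H \<and> tangent s (X, 1)"
    if X: "X \<in> bigs" "norm (c - X) = 1 + r" for X
  proof -
    \<comment> \<open>The point of contact: it is on the unit disc, and in the closure of the hole
      because the open small disc lies in the hole.\<close>
    define p where "p = X + (1 / (1 + r)) *\<^sub>R (c - X)"
    have p1: "norm (p - X) = 1" using X r_simps(1) by (simp add: p_def)
    have "c - p = (r / (1 + r)) *\<^sub>R (c - X)"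
    proof -
      have "1 = r / (1 + r) + 1 / (1 + r)" using r_simps(1) by (simp add: add_divide_distrib[symmetric])
      hence "c - X = (r / (1 + r) + 1 / (1 + r)) *\<^sub>R (c - X)" by simp
      hence "c - X = (r / (1 + r)) *\<^sub>R (c - X) + (1 / (1 + r)) *\<^sub>R (c - X)" by (simp only: scaleR_add_left)
      thus ?thesis unfolding p_def by (simp add: algebra_simps)
    qed
    hence "norm (c - p) = r" using X r_simps(1) by simp
    hence "p \<in> closure (ball c r)" using r_simps(1) by (simp add: dist_norm)
    hence "p \<in> closure H" using closure_mono[OF b] by blast
    moreover have "p \<in> body (X, 1)" using p1 by (simp add: body_def dist_norm norm_minus_commute)
    ultimately show ?thesis using X c by (auto simp: bounding_discs_def tangent_def dist_norm)
  qed
  have dE: "norm (c - E) = 1 + r" "norm (c - (E + 2 * v)) = 1 + r"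
    using dist_frame[OF v, of E apex 0] dist_frame[OF v, of E apex 2] norm_apex norm_apex_other r_simps
    by (simp_all add: E small_at_def dist_norm mult.commute)
  have "{B \<in> bounding_discs (unit_discs bigs) H. tangent s B} = {(E, 1), (E + 2 * v, 1)}"
  proof (intro equalityI subsetI)
    fix B assume "B \<in> {B \<in> bounding_discs (unit_discs bigs) H. tangent s B}"
    then obtain X where X: "B = (X, 1)" "X \<in> bigs" "norm (X - small_at E v) = 1 + r"
      by (auto simp: bounding_discs_def tangent_def c E dist_norm norm_minus_commute)
    thus "B \<in> {(E, 1), (E + 2 * v, 1)}" using lattice.dist_big_small(2)[OF E(1) X(2,3)] by auto
  qed (use touch EB dE in blast)
  moreover have "v \<noteq> 0" using v by auto
  ultimately show "card {B \<in> bounding_discs (unit_discs bigs) H. tangent s B} = 2" by simp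
next
  fix s t assume st: "s \<in> occupants H" "t \<in> occupants H" "s \<noteq> t"
  have u: "norm u = 1" using f by (auto simp: filled_def)
  show "tangent s t" using st unfolding occupants_eq[OF assms]
    by (elim insertE emptyE; simp only: tangent_frame[OF u] norm_apexes r_simps norm_minus_commute[of apex2 apex]
      norm_minus_commute[of apex3 apex] norm_minus_commute[of apex3 apex2])
qed

lemma decomposition:
  "\<exists>T S C. triangular_lattice_packing T \<and> S \<subseteq> holes T \<and> S \<noteq> {} \<and>
    (\<forall>H\<in>S. is_cluster T r H (C H)) \<and> P = T \<union> (\<Union>H\<in>S. C H)"
proof (intro exI conjI)
  let ?T = "unit_discs bigs"
  define S where "S = {H \<in> holes ?T. occupants H \<noteq> {}}"
  show "triangular_lattice_packing ?T" by (rule hexagonal_imp_triangular[OF hexagonal_bigs bigs_nonempty])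
  show "S \<subseteq> holes ?T" by (auto simp: S_def)
  have in_hole: "\<exists>H\<in>S. (c, r) \<in> occupants H" if c: "(c, r) \<in> P" for c
  proof -
    have "c \<in> \<Union> (components gaps)" using small_in_gaps[OF c] r_simps(1) by auto
    thus ?thesis using c unfolding S_def holes_eq occupants_def by blast
  qed
  have "r \<in> radius ` P" using radii by simp
  then obtain D where "D \<in> P" "radius D = r" by auto
  thus "S \<noteq> {}" using in_hole by (cases D) auto
  show "\<forall>H\<in>S. is_cluster ?T r H (occupants H)"
  proof
    fix H assume "H \<in> S"
    then obtain c where "H \<in> holes ?T" "(c, r) \<in> P" "c \<in> H" by (auto simp: S_def occupants_def)
    thus "is_cluster ?T r H (occupants H)" using occupants_cluster smalls_filled by metis
  qed
  show "P = ?T \<union> (\<Union>H\<in>S. occupants H)"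
  proof (intro equalityI subsetI)
    fix D assume "D \<in> P"
    moreover obtain c x where "D = (c, x)" by (cases D)
    ultimately show "D \<in> ?T \<union> (\<Union>H\<in>S. occupants H)"
      using disc_radius[of c x] in_hole by (auto simp: bigs_def)
  qed (auto simp: bigs_def occupants_def)
qed

end

theorem mainTheorem5:
  fixes r :: real and P :: "disc set"
  assumes "r = 5 - 2 * sqrt 6"
  shows "compact_packing_using 1 r P \<longleftrightarrow>
    (\<exists>T S C. triangular_lattice_packing T \<and>
       S \<subseteq> holes T \<and> S \<noteq> {} \<and>
       (\<forall>H\<in>S. is_cluster T r H (C H)) \<and>
       P = T \<union> (\<Union>H\<in>S. C H))"
proof
  assume "compact_packing_using 1 r P"
  then interpret compact_two_radii P r using assms by unfold_locales
  show "\<exists>T S C. triangular_lattice_packing T \<and> S \<subseteq> holes T \<and> S \<noteq> {} \<and>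
      (\<forall>H\<in>S. is_cluster T r H (C H)) \<and> P = T \<union> (\<Union>H\<in>S. C H)"
    by (rule decomposition)
next
  assume "\<exists>T S C. triangular_lattice_packing T \<and> S \<subseteq> holes T \<and> S \<noteq> {} \<and>
      (\<forall>H\<in>S. is_cluster T r H (C H)) \<and> P = T \<union> (\<Union>H\<in>S. C H)"
  thus "compact_packing_using 1 r P" using compact_packing_of_clusters[OF assms] by blast
qed

end
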